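(* Let $(\Gamma_1,\Gamma_2,\tau)$ be a Belavin–Drinfel'd triple for $\mathfrak g=sl_n(\mathbb{C})$. Suppose that $\tau$ can be extended to an isomorphism $\hat\tau\colon \mathcal A(\mathfrak g_1)\to\mathcal A(\mathfrak g_2)$ of associative algebras with no stable points, i.e. such that for every $\eta\in\hat\Gamma_1$ there is a positive integer $m$ such that $\eta,\hat\tau(\eta),\dots,\hat\tau^{m-1}(\eta)\in\hat\Gamma_1$ and $\hat\tau^{m}(\eta)\notin\hat\Gamma_1$. Then the algebra $\mathfrak M=\mathfrak d_2\oplus\mathfrak R\oplus\mathfrak R$ with the inner product determined by $t_{\mathfrak M}$, together with $\mathfrak M_\pm=\mathfrak D+\mathfrak N_\pm$, forms an associative triple, with the subalgebras $\mathfrak N_-,\mathfrak D,\mathfrak N_+$ defined in the context.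
   Context: Associative triple: let $\mathfrak M$ be a finite-dimensional unital associative $\mathbb{C}$-algebra with a non-degenerate symmetric bilinear form $(\cdot,\cdot)$ that is cyclic, $(xy,z)=(y,zx)$. Suppose $\mathfrak M$ is the linear sum $\mathfrak N_-+\mathfrak D+\mathfrak N_+$ of three (not necessarily unital) subalgebras such that (i) the form restricts to a non-degenerate pairing between $\mathfrak N_+$ and $\mathfrak N_-$; (ii) $\mathfrak N_\pm$ are $\mathfrak D$-bimodules under multiplication; (iii) $\mathfrak D$ is orthogonal to $\mathfrak N_-+\mathfrak N_+$. With $\mathfrak M_\pm=\mathfrak D+\mathfrak N_\pm$, the set $(\mathfrak M,\mathfrak M_+,\mathfrak M_-)$ is called an associative triple with diagonal $\mathfrak D=\mathfrak M_+\cap\mathfrak M_-$. Setup. $\mathfrak R=\mathrm{Mat}_n(\mathbb{C})$ with matrix units $E_{ij}$; $\mathfrak g=sl_n(\mathbb{C})$; $\mathfrak n_+$, $\mathfrak n_-$ are the strictly upper and strictly lower triangular matrices. The simple roots are $\alpha_1,\dots,\alpha_{n-1}$, with root vectors $e_{\alpha_i}=E_{i,i+1}$, $f_{\alpha_i}=E_{i+1,i}$. The positive root $\gamma=\alpha_i+\dots+\alpha_{j-1}$ ($i<j$) has root vectors $e_\gamma=E_{ij}$, $f_\gamma=E_{ji}$; $\Delta^+$ is the set of positive roots. A Belavin–Drinfel'd triple consists of two subsets $\Gamma_1,\Gamma_2$ of the simple roots and a bijection $\tau\colon\Gamma_1\to\Gamma_2$ preserving the Killing form such that for every $\alpha\in\Gamma_1$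 there is a positive integer $k$ with $\tau^{k-1}(\alpha)\in\Gamma_1$ and $\tau^k(\alpha)\notin\Gamma_1$. For $i=1,2$, $\Delta_i$ is the root subsystem generated by $\Gamma_i$ and $\mathfrak g_i\subset\mathfrak g$ is the semisimple Lie subalgebra with root system $\Delta_i$. The map $\tau$ extends to a Lie algebra isomorphism $\mathfrak g_1\to\mathfrak g_2$ with $e_\alpha\mapsto e_{\tau(\alpha)}$, $f_\alpha\mapsto f_{\tau(\alpha)}$ for $\alpha\in\Gamma_1$. $\mathcal A(\mathfrak g_i)\subset\mathfrak R$ is the associative subalgebra (not necessarily containing the identity matrix) generated by $\mathfrak g_i$; it is a direct sum of full matrix blocks. An extension $\hat\tau$ of $\tau$ means an isomorphism of associative algebras $\mathcal A(\mathfrak g_1)\to\mathcal A(\mathfrak g_2)$ restricting to this Lie algebra isomorphism. Put $\hat\Gamma=\{\eta_1,\dots,\eta_n\}$ with $\eta_i=E_{ii}$, and $\hat\Gamma_i=\hat\Gamma\cap\mathcal A(\mathfrak g_i)$; $\hat\tau$ restricts to a bijection $\hat\Gamma_1\to\hat\Gamma_2$. Algebras (the first two items lie in $\mathfrak R\oplus\mathfrak R$ with componentwise multiplication): - $\mathfrak B$ is the subalgebra of $(\mathcal A(\mathfrak g_1)+\mathfrak n_+)\oplus(\mathcal A(\mathfrak g_2)+\mathfrak n_-)$ obtained by identifying $\mathcal A(\mathfrak g_1)$ and $\mathcal A(\mathfrak g_2)$ via $\hat\tau$, i.e. $\mathfrak B=\{(a+u,\hat\tau(a)+v): a\in\mathcal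 A(\mathfrak g_1),\ u\in\mathrm{Span}\{e_\gamma:\gamma\in\Delta^+\setminus\Delta_1\},\ v\in\mathrm{Span}\{f_\gamma:\gamma\in\Delta^+\setminus\Delta_2\}\}$. - $\mathfrak d_1=\mathrm{Span}\{(\eta,0):\eta\in\hat\Gamma\setminus\hat\Gamma_1\}$, $\mathfrak d_2=\mathrm{Span}\{(0,\eta):\eta\in\hat\Gamma\setminus\hat\Gamma_2\}$; the sum $\mathfrak B+\mathfrak d_1+\mathfrak d_2$ is a direct sum of vector spaces and a subalgebra of $\mathfrak R\oplus\mathfrak R$. Put $\mathfrak d=(\mathfrak B+\mathfrak d_1+\mathfrak d_2)\cap\{(x,x):x\in\mathfrak R\}$, which is a commutative subalgebra of $\mathbb{C}\hat\Gamma\oplus\mathbb{C}\hat\Gamma$, and let $\gamma_2\colon\mathfrak d\to\mathfrak d_2$ be the restriction to $\mathfrak d$ of the projection $\mathfrak B+\mathfrak d_1+\mathfrak d_2\to\mathfrak d_2$. - Identifying $\mathfrak d_2$ with the subalgebra $\mathrm{Span}(\hat\Gamma\setminus\hat\Gamma_2)\subset\mathfrak R$ via the second component, $\mathfrak M=\mathfrak d_2\oplus\mathfrak R\oplus\mathfrak R$ (direct sum of algebras), and $\mathfrak D=\{(\gamma_2(x,x),x,x):(x,x)\in\mathfrak d\}$, $\mathfrak N_-=\{(0,a,a):a\in\mathfrak R\}$, $\mathfrak N_+=\{(y,0,y):y\in\gamma_2(\mathfrak d)\}+\{(0,b_1,b_2):(b_1,b_2)\in\mathfrak B\}$. - The inner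 product on $\mathfrak M$ is $(x,x')=t_{\mathfrak M}(xx')$, where $t_{\mathfrak M}(y,a,b)=\mathrm{Tr}(y)+\mathrm{Tr}(a)-\mathrm{Tr}(b)$. *)

theory Defs
  imports "HOL-Analysis.Analysis"
begin

section \<open>Associative triples\<close>

text \<open>
  The algebra is carried by a subspace \<open>M\<close> of an ambient complex vector space; \<open>mult\<close> and \<open>form\<close>
  are only constrained on \<open>M\<close>.
\<close>

locale fd_unital_algebra = vector_space scale
  for scale :: "complex \<Rightarrow> 'a::ab_group_add \<Rightarrow> 'a" +
  fixes mult :: "'a \<Rightarrow> 'a \<Rightarrow> 'a" and M :: "'a set"
  assumes carrier_subspace: "subspace M"
    and carrier_finite_dim: "\<exists>S. finite S \<and> S \<subseteq> M \<and> M \<subseteq> span S"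
    and mult_closed: "\<lbrakk>x \<in> M; y \<in> M\<rbrakk> \<Longrightarrow> mult x y \<in> M"
    and mult_add_left: "\<lbrakk>x \<in> M; y \<in> M; z \<in> M\<rbrakk> \<Longrightarrow> mult (x + y) z = mult x z + mult y z"
    and mult_add_right: "\<lbrakk>x \<in> M; y \<in> M; z \<in> M\<rbrakk> \<Longrightarrow> mult x (y + z) = mult x y + mult x z"
    and mult_scale_left: "\<lbrakk>x \<in> M; y \<in> M\<rbrakk> \<Longrightarrow> mult (scale c x) y = scale c (mult x y)"
    and mult_scale_right: "\<lbrakk>x \<in> M; y \<in> M\<rbrakk> \<Longrightarrow> mult x (scale c y) = scale c (mult x y)"
    and mult_assoc: "\<lbrakk>x \<in> M; y \<in> M; z \<in> M\<rbrakk> \<Longrightarrow> mult (mult x y) z = mult x (mult y z)"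
    and unit_exists: "\<exists>e\<in>M. \<forall>x\<in>M. mult e x = x \<and> mult x e = x"
begin

definition subalgebra :: "'a set \<Rightarrow> bool" where
  "subalgebra N \<longleftrightarrow> N \<subseteq> M \<and> subspace N \<and> (\<forall>x\<in>N. \<forall>y\<in>N. mult x y \<in> N)"

text \<open>
  Bimodule under multiplication: the remaining bimodule axioms are inherited from \<open>M\<close>.
\<close>

definition bimodule_over :: "'a set \<Rightarrow> 'a set \<Rightarrow> bool" where
  "bimodule_over D N \<longleftrightarrow> (\<forall>d\<in>D. \<forall>x\<in>N. mult d x \<in> N \<and> mult x d \<in> N)"

end

text \<open>
  The triple is \<open>(M, Mp, Mm)\<close>, with diagonal \<open>D\<close> and nilpotent parts \<open>Nm\<close>, \<open>Np\<close>.
  Sums of subsets are elementwise, and are not required to be direct.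
\<close>

locale associative_triple = fd_unital_algebra scale mult M
  for scale :: "complex \<Rightarrow> 'a::ab_group_add \<Rightarrow> 'a" and mult :: "'a \<Rightarrow> 'a \<Rightarrow> 'a" and M :: "'a set" +
  fixes form :: "'a \<Rightarrow> 'a \<Rightarrow> complex"
    and Mp Mm Nm D Np :: "'a set"
  assumes form_add_left: "\<lbrakk>x \<in> M; y \<in> M; z \<in> M\<rbrakk> \<Longrightarrow> form (x + y) z = form x z + form y z"
    and form_scale_left: "\<lbrakk>x \<in> M; y \<in> M\<rbrakk> \<Longrightarrow> form (scale c x) y = c * form x y"
    and form_sym: "\<lbrakk>x \<in> M; y \<in> M\<rbrakk> \<Longrightarrow> form x y = form y x"
    and form_nondegenerate: "\<lbrakk>x \<in> M; \<And>y. y \<in> M \<Longrightarrow> form x y = 0\<rbrakk> \<Longrightarrow> x = 0"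
    and form_cyclic: "\<lbrakk>x \<in> M; y \<in> M; z \<in> M\<rbrakk> \<Longrightarrow> form (mult x y) z = form y (mult z x)"
    and subalgebra_Nm: "subalgebra Nm"
    and subalgebra_D: "subalgebra D"
    and subalgebra_Np: "subalgebra Np"
    and linear_sum: "M = Nm + D + Np"
    and pairing_nondegenerate_left: "\<lbrakk>x \<in> Np; \<And>y. y \<in> Nm \<Longrightarrow> form x y = 0\<rbrakk> \<Longrightarrow> x = 0"
    and pairing_nondegenerate_right: "\<lbrakk>y \<in> Nm; \<And>x. x \<in> Np \<Longrightarrow> form x y = 0\<rbrakk> \<Longrightarrow> y = 0"
    and bimodule_Np: "bimodule_over D Np"
    and bimodule_Nm: "bimodule_over D Nm"
    and D_orthogonal: "\<lbrakk>d \<in> D; x \<in> Nm + Np\<rbrakk> \<Longrightarrow> form d x = 0"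
    and Mp_eq: "Mp = D + Np"
    and Mm_eq: "Mm = D + Nm"
    and diagonal: "D = Mp \<inter> Mm"


section \<open>Complex matrices and direct sums of matrix algebras\<close>

text \<open>
  Rows and columns are indexed by an arbitrary finite linearly ordered type \<open>'n\<close> in place of
  \<open>{1..n}\<close>, so \<open>n = CARD('n)\<close>.  The ring product of matrices is \<open>**\<close>; the type class product \<open>*\<close> on
  \<open>complex^'n^'n\<close> is entrywise and is not used.
\<close>

type_synonym 'n cmat = "complex^'n^'n"

definition mscale :: "complex \<Rightarrow> 'n::finite cmat \<Rightarrow> 'n cmat" where
  "mscale c A = (\<chi> i j. c * A $ i $ j)"

interpretation mat_vs: vector_space mscale
  by unfold_locales (simp_all add: mscale_def vec_eq_iff algebra_simps)

interpretation mat2_vs: vector_space_prod mscale mscale ..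

interpretation mat3_vs: vector_space_prod mscale mat2_vs.scale ..

definition mult3 :: "'n::finite cmat \<times> 'n cmat \<times> 'n cmat \<Rightarrow> 'n cmat \<times> 'n cmat \<times> 'n cmat
    \<Rightarrow> 'n cmat \<times> 'n cmat \<times> 'n cmat" where
  "mult3 = (\<lambda>(y, a, b) (y', a', b'). (y ** y', a ** a', b ** b'))"

definition matrix_unit :: "'n::finite \<Rightarrow> 'n \<Rightarrow> 'n cmat" where
  "matrix_unit i j = (\<chi> k l. if k = i \<and> l = j then 1 else 0)"

definition lie_bracket :: "'n::finite cmat \<Rightarrow> 'n cmat \<Rightarrow> 'n cmat" where
  "lie_bracket x y = x ** y - y ** x"

definition lie_subalgebra :: "'n::finite cmat set \<Rightarrow> bool" where
  "lie_subalgebra S \<longleftrightarrow> mat_vs.subspace S \<and> (\<forall>x\<in>S. \<forall>y\<in>S. lie_bracket x y \<in> S)"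

definition assoc_subalgebra :: "'n::finite cmat set \<Rightarrow> bool" where
  "assoc_subalgebra S \<longleftrightarrow> mat_vs.subspace S \<and> (\<forall>x\<in>S. \<forall>y\<in>S. x ** y \<in> S)"

definition linear_iso_on :: "'n::finite cmat set \<Rightarrow> 'n cmat set \<Rightarrow> ('n cmat \<Rightarrow> 'n cmat) \<Rightarrow> bool" where
  "linear_iso_on S T \<phi> \<longleftrightarrow> bij_betw \<phi> S T \<and>
     (\<forall>x\<in>S. \<forall>y\<in>S. \<phi> (x + y) = \<phi> x + \<phi> y) \<and> (\<forall>c. \<forall>x\<in>S. \<phi> (mscale c x) = mscale c (\<phi> x))"

definition lie_iso :: "'n::finite cmat set \<Rightarrow> 'n cmat set \<Rightarrow> ('n cmat \<Rightarrow> 'n cmat) \<Rightarrow> bool" where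
  "lie_iso S T \<phi> \<longleftrightarrow> linear_iso_on S T \<phi> \<and>
     (\<forall>x\<in>S. \<forall>y\<in>S. \<phi> (lie_bracket x y) = lie_bracket (\<phi> x) (\<phi> y))"

definition assoc_iso :: "'n::finite cmat set \<Rightarrow> 'n cmat set \<Rightarrow> ('n cmat \<Rightarrow> 'n cmat) \<Rightarrow> bool" where
  "assoc_iso S T \<phi> \<longleftrightarrow> linear_iso_on S T \<phi> \<and> (\<forall>x\<in>S. \<forall>y\<in>S. \<phi> (x ** y) = \<phi> x ** \<phi> y)"


section \<open>Roots and Killing form of the special linear Lie algebra\<close>

definition sl :: "'n::finite cmat set" where
  "sl = {A. trace A = 0}"

definition cartan :: "'n::finite cmat set" where
  "cartan = {h \<in> sl. \<forall>i j. i \<noteq> j \<longrightarrow> h $ i $ j = 0}"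

text \<open>
  The pair \<open>(i, j)\<close> with \<open>i \<noteq> j\<close> stands for the root whose root space is spanned by
  \<open>matrix_unit i j\<close>; \<open>root_val\<close> is that root as a functional on \<open>cartan\<close>.
\<close>

definition roots :: "('n \<times> 'n) set" where
  "roots = {(i, j). i \<noteq> j}"

definition root_val :: "'n::finite \<times> 'n \<Rightarrow> 'n cmat \<Rightarrow> complex" where
  "root_val \<gamma> h = h $ fst \<gamma> $ fst \<gamma> - h $ snd \<gamma> $ snd \<gamma>"

definition positive_roots :: "('n::linorder \<times> 'n) set" where
  "positive_roots = {(i, j). i < j}"

definition simple_roots :: "('n::linorder \<times> 'n) set" where
  "simple_roots = {(i, j). i < j \<and> (\<nexists>k. i < k \<and> k < j)}"

definition e_vec :: "'n::finite \<times> 'n \<Rightarrow> 'n cmat" where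
  "e_vec \<gamma> = matrix_unit (fst \<gamma>) (snd \<gamma>)"

definition f_vec :: "'n::finite \<times> 'n \<Rightarrow> 'n cmat" where
  "f_vec \<gamma> = matrix_unit (snd \<gamma>) (fst \<gamma>)"

text \<open>Trace of a linear operator \<open>T\<close> on an invariant subspace \<open>S\<close>, computed in some basis of \<open>S\<close>.\<close>

definition operator_trace :: "'n::finite cmat set \<Rightarrow> ('n cmat \<Rightarrow> 'n cmat) \<Rightarrow> complex" where
  "operator_trace S T =
     (let B = (SOME B. B \<subseteq> S \<and> mat_vs.independent B \<and> S \<subseteq> mat_vs.span B)
      in \<Sum>b\<in>B. mat_vs.representation B (T b) b)"

definition killing_form :: "'n::finite cmat \<Rightarrow> 'n cmat \<Rightarrow> complex" where
  "killing_form x y = operator_trace sl (\<lambda>z. lie_bracket x (lie_bracket y z))"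

text \<open>
  The form induced on roots by the Killing form, through the identification of \<open>cartan\<close> with its
  dual.
\<close>

definition killing_dual :: "'n::finite \<times> 'n \<Rightarrow> 'n cmat" where
  "killing_dual \<gamma> = (THE t. t \<in> cartan \<and> (\<forall>h\<in>cartan. killing_form t h = root_val \<gamma> h))"

definition killing_root_form :: "'n::finite \<times> 'n \<Rightarrow> 'n \<times> 'n \<Rightarrow> complex" where
  "killing_root_form \<alpha> \<beta> = killing_form (killing_dual \<alpha>) (killing_dual \<beta>)"


section \<open>Belavin--Drinfel'd triples and their extensions\<close>

text \<open>
  \<open>\<tau>\<close> is a partial map with domain \<open>\<Gamma>1\<close>, represented by a total function; an iterate \<open>\<tau>\<^sup>k \<alpha>\<close> is
  meaningful only when all earlier iterates lie in \<open>\<Gamma>1\<close>.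
\<close>

definition BD_triple ::
    "('n::{finite,linorder} \<times> 'n) set \<Rightarrow> ('n \<times> 'n) set \<Rightarrow> ('n \<times> 'n \<Rightarrow> 'n \<times> 'n) \<Rightarrow> bool" where
  "BD_triple \<Gamma>1 \<Gamma>2 \<tau> \<longleftrightarrow>
     \<Gamma>1 \<subseteq> simple_roots \<and> \<Gamma>2 \<subseteq> simple_roots \<and> bij_betw \<tau> \<Gamma>1 \<Gamma>2 \<and>
     (\<forall>\<alpha>\<in>\<Gamma>1. \<forall>\<beta>\<in>\<Gamma>1. killing_root_form (\<tau> \<alpha>) (\<tau> \<beta>) = killing_root_form \<alpha> \<beta>) \<and>
     (\<forall>\<alpha>\<in>\<Gamma>1. \<exists>k>0. (\<forall>j<k. (\<tau> ^^ j) \<alpha> \<in> \<Gamma>1) \<and> (\<tau> ^^ k) \<alpha> \<notin> \<Gamma>1)"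

text \<open>The root subsystem generated by \<open>\<Gamma>\<close>: the roots that are integral combinations of \<open>\<Gamma>\<close>.\<close>

definition root_subsystem :: "('n::finite \<times> 'n) set \<Rightarrow> ('n \<times> 'n) set" where
  "root_subsystem \<Gamma> = {\<gamma> \<in> roots. \<exists>c :: 'n \<times> 'n \<Rightarrow> int.
     \<forall>h\<in>cartan. root_val \<gamma> h = (\<Sum>\<alpha>\<in>\<Gamma>. of_int (c \<alpha>) * root_val \<alpha> h)}"

text \<open>
  The subsystem contains \<open>(j, i)\<close> along with \<open>(i, j)\<close>, so both root vectors and their brackets lie in
  \<open>g_sub \<Gamma>\<close>: it is the semisimple Lie subalgebra with root system \<open>root_subsystem \<Gamma>\<close>.
\<close>

definition g_sub :: "('n::finite \<times> 'n) set \<Rightarrow> 'n cmat set" where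
  "g_sub \<Gamma> = lie_subalgebra hull (e_vec ` root_subsystem \<Gamma>)"

definition A_sub :: "('n::finite \<times> 'n) set \<Rightarrow> 'n cmat set" where
  "A_sub \<Gamma> = assoc_subalgebra hull (g_sub \<Gamma>)"

definition lie_extension :: "('n::finite \<times> 'n) set \<Rightarrow> ('n \<times> 'n) set \<Rightarrow> ('n \<times> 'n \<Rightarrow> 'n \<times> 'n)
    \<Rightarrow> ('n cmat \<Rightarrow> 'n cmat) \<Rightarrow> bool" where
  "lie_extension \<Gamma>1 \<Gamma>2 \<tau> \<phi> \<longleftrightarrow> lie_iso (g_sub \<Gamma>1) (g_sub \<Gamma>2) \<phi> \<and>
     (\<forall>\<alpha>\<in>\<Gamma>1. \<phi> (e_vec \<alpha>) = e_vec (\<tau> \<alpha>) \<and> \<phi> (f_vec \<alpha>) = f_vec (\<tau> \<alpha>))"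

definition assoc_extension :: "('n::finite \<times> 'n) set \<Rightarrow> ('n \<times> 'n) set \<Rightarrow> ('n \<times> 'n \<Rightarrow> 'n \<times> 'n)
    \<Rightarrow> ('n cmat \<Rightarrow> 'n cmat) \<Rightarrow> bool" where
  "assoc_extension \<Gamma>1 \<Gamma>2 \<tau> \<tau>h \<longleftrightarrow> assoc_iso (A_sub \<Gamma>1) (A_sub \<Gamma>2) \<tau>h \<and>
     (\<exists>\<phi>. lie_extension \<Gamma>1 \<Gamma>2 \<tau> \<phi> \<and> (\<forall>x\<in>g_sub \<Gamma>1. \<tau>h x = \<phi> x))"

definition hat_Gamma :: "'n::finite cmat set" where
  "hat_Gamma = range (\<lambda>i. matrix_unit i i)"

definition hat_sub :: "('n::finite \<times> 'n) set \<Rightarrow> 'n cmat set" where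
  "hat_sub \<Gamma> = hat_Gamma \<inter> A_sub \<Gamma>"

definition no_stable_points :: "('n::finite \<times> 'n) set \<Rightarrow> ('n cmat \<Rightarrow> 'n cmat) \<Rightarrow> bool" where
  "no_stable_points \<Gamma>1 \<tau>h \<longleftrightarrow> (\<forall>\<eta>\<in>hat_sub \<Gamma>1. \<exists>m>0.
     (\<forall>k<m. (\<tau>h ^^ k) \<eta> \<in> hat_sub \<Gamma>1) \<and> (\<tau>h ^^ m) \<eta> \<notin> hat_sub \<Gamma>1)"


section \<open>The algebras\<close>

definition alg_B :: "('n::{finite,linorder} \<times> 'n) set \<Rightarrow> ('n \<times> 'n) set \<Rightarrow> ('n cmat \<Rightarrow> 'n cmat)
    \<Rightarrow> ('n cmat \<times> 'n cmat) set" where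
  "alg_B \<Gamma>1 \<Gamma>2 \<tau>h = {(a + u, \<tau>h a + v) | a u v. a \<in> A_sub \<Gamma>1 \<and>
     u \<in> mat_vs.span (e_vec ` (positive_roots - root_subsystem \<Gamma>1)) \<and>
     v \<in> mat_vs.span (f_vec ` (positive_roots - root_subsystem \<Gamma>2))}"

definition alg_d1 :: "('n::finite \<times> 'n) set \<Rightarrow> ('n cmat \<times> 'n cmat) set" where
  "alg_d1 \<Gamma>1 = mat2_vs.p.span ((\<lambda>\<eta>. (\<eta>, 0)) ` (hat_Gamma - hat_sub \<Gamma>1))"

definition alg_d2 :: "('n::finite \<times> 'n) set \<Rightarrow> ('n cmat \<times> 'n cmat) set" where
  "alg_d2 \<Gamma>2 = mat2_vs.p.span ((\<lambda>\<eta>. (0, \<eta>)) ` (hat_Gamma - hat_sub \<Gamma>2))"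

definition alg_d :: "('n::{finite,linorder} \<times> 'n) set \<Rightarrow> ('n \<times> 'n) set \<Rightarrow> ('n cmat \<Rightarrow> 'n cmat)
    \<Rightarrow> ('n cmat \<times> 'n cmat) set" where
  "alg_d \<Gamma>1 \<Gamma>2 \<tau>h = (alg_B \<Gamma>1 \<Gamma>2 \<tau>h + alg_d1 \<Gamma>1 + alg_d2 \<Gamma>2) \<inter> range (\<lambda>x. (x, x))"

text \<open>
  Projection to \<open>alg_d2\<close> along \<open>alg_B + alg_d1\<close>; it is only applied to elements of \<open>alg_d\<close>, where the
  description is unique since the sum of the three subspaces is direct.
\<close>

definition gamma2 :: "('n::{finite,linorder} \<times> 'n) set \<Rightarrow> ('n \<times> 'n) set \<Rightarrow> ('n cmat \<Rightarrow> 'n cmat)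
    \<Rightarrow> 'n cmat \<times> 'n cmat \<Rightarrow> 'n cmat \<times> 'n cmat" where
  "gamma2 \<Gamma>1 \<Gamma>2 \<tau>h z =
     (THE y. y \<in> alg_d2 \<Gamma>2 \<and> (\<exists>b\<in>alg_B \<Gamma>1 \<Gamma>2 \<tau>h. \<exists>w\<in>alg_d1 \<Gamma>1. z = b + w + y))"

text \<open>Below, \<open>snd\<close> is the identification of \<open>alg_d2\<close> with a subalgebra of the matrix algebra.\<close>

definition alg_M :: "('n::finite \<times> 'n) set \<Rightarrow> ('n cmat \<times> 'n cmat \<times> 'n cmat) set" where
  "alg_M \<Gamma>2 = snd ` alg_d2 \<Gamma>2 \<times> UNIV \<times> UNIV"

definition alg_D :: "('n::{finite,linorder} \<times> 'n) set \<Rightarrow> ('n \<times> 'n) set \<Rightarrow> ('n cmat \<Rightarrow> 'n cmat)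
    \<Rightarrow> ('n cmat \<times> 'n cmat \<times> 'n cmat) set" where
  "alg_D \<Gamma>1 \<Gamma>2 \<tau>h = {(snd (gamma2 \<Gamma>1 \<Gamma>2 \<tau>h (x, x)), x, x) | x. (x, x) \<in> alg_d \<Gamma>1 \<Gamma>2 \<tau>h}"

definition alg_Nminus :: "('n::finite cmat \<times> 'n cmat \<times> 'n cmat) set" where
  "alg_Nminus = {(0, a, a) | a. True}"

definition alg_Nplus :: "('n::{finite,linorder} \<times> 'n) set \<Rightarrow> ('n \<times> 'n) set \<Rightarrow> ('n cmat \<Rightarrow> 'n cmat)
    \<Rightarrow> ('n cmat \<times> 'n cmat \<times> 'n cmat) set" where
  "alg_Nplus \<Gamma>1 \<Gamma>2 \<tau>h =
     {(y, 0, y) | y. y \<in> snd ` gamma2 \<Gamma>1 \<Gamma>2 \<tau>h ` alg_d \<Gamma>1 \<Gamma>2 \<tau>h} +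
     {(0, b1, b2) | b1 b2. (b1, b2) \<in> alg_B \<Gamma>1 \<Gamma>2 \<tau>h}"

definition trace_M :: "'n::finite cmat \<times> 'n cmat \<times> 'n cmat \<Rightarrow> complex" where
  "trace_M = (\<lambda>(y, a, b). trace y + trace a - trace b)"

definition form_M :: "'n::finite cmat \<times> 'n cmat \<times> 'n cmat \<Rightarrow> 'n cmat \<times> 'n cmat \<times> 'n cmat \<Rightarrow> complex"
  where "form_M x x' = trace_M (mult3 x x')"

end

theory Submission
  imports Defs
begin

text \<open>
  \<open>\<A>(\<gg>\<^sub>i)\<close> consists of the matrices supported on the diagonal blocks cut out by \<open>\<Gamma>\<^sub>i\<close>, and the
  extension of \<open>\<tau>\<close> is \<open>E\<^sub>i\<^sub>j \<mapsto> E\<^sub>t\<^sub>i\<^sub>,\<^sub>t\<^sub>j\<close> for a bijection \<open>t\<close> between the block supports \<open>I1\<close> and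
  \<open>I2\<close>, order preserving on each block.  Having no stable points means that \<open>t\<close>, as a partial map,
  can be iterated only finitely often, in either direction.  Hence in a pair \<open>(x, x)\<close>
  satisfying the relations \<open>x\<^sub>i\<^sub>j = x\<^sub>t\<^sub>i\<^sub>,\<^sub>t\<^sub>j\<close> and the triangularity conditions, each off-diagonal entry is
  transported along \<open>t\<close> until it meets a zero, so \<open>x\<close> is diagonal and constant on the \<open>t\<close>-chains;
  dually, every \<open>E\<^sub>i\<^sub>j\<close> is reached by finitely many shifts \<open>E\<^sub>i\<^sub>j - E\<^sub>t\<^sub>i\<^sub>,\<^sub>t\<^sub>j\<close>, so the differences \<open>b - c\<close>
  with \<open>(y, b, c) \<in> \<N>\<^sub>+\<close> fill all of \<open>Mat\<^sub>n\<close>.  The first fact gives non-degeneracy on \<open>\<N>\<^sub>+\<close> and the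
  orthogonality of \<open>\<D>\<close>, the second the decomposition of \<open>\<M>\<close> and non-degeneracy on \<open>\<N>\<^sub>-\<close>.
\<close>

section \<open>Matrices with prescribed support\<close>

text \<open>The subspaces that occur (blocks, spans of root vectors, diagonal subalgebras) are
  spanned by matrix units, so each is recorded by its set of positions; closure under products
  becomes composability of positions.\<close>

definition supported_on :: "('n::finite \<times> 'n) set \<Rightarrow> 'n cmat set" where
  "supported_on S = {A. \<forall>i j. A $ i $ j \<noteq> 0 \<longrightarrow> (i, j) \<in> S}"

lemma supported_onD: "A \<in> supported_on S \<Longrightarrow> (i, j) \<notin> S \<Longrightarrow> A $ i $ j = 0"
  by (auto simp: supported_on_def)

lemma matrix_unit_nth [simp]: "matrix_unit i j $ k $ l = (if k = i \<and> l = j then 1 else 0)"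
  by (simp add: matrix_unit_def)

lemma mscale_nth [simp]: "mscale c A $ i $ j = c * A $ i $ j"
  by (simp add: mscale_def)

lemma matrix_mult_nth: "(A ** B) $ i $ j = (\<Sum>k\<in>UNIV. A $ i $ k * B $ k $ j)"
  by (simp add: matrix_matrix_mult_def)

lemma matrix_unit_mult:
  "matrix_unit i j ** matrix_unit k l = (if j = k then matrix_unit i l else 0)"
proof -
  have "(\<Sum>m\<in>UNIV. (if p = i \<and> m = j then 1 else 0) * (if m = k \<and> q = l then 1 else 0))
      = (\<Sum>m\<in>UNIV. if m = j then (if p = i \<and> j = k \<and> q = l then 1 else 0) else (0::complex))" for p q
    by (rule sum.cong) auto
  then show ?thesis
    by (auto simp: vec_eq_iff matrix_mult_nth)
qed

lemma matrix_unit_inject [simp]: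
  "matrix_unit i j = matrix_unit k l \<longleftrightarrow> i = k \<and> j = l"
proof
  assume "matrix_unit i j = matrix_unit k l"
  then have "matrix_unit i j $ i $ j = matrix_unit k l $ i $ j" by simp
  then show "i = k \<and> j = l" by (auto split: if_splits)
qed simp

lemma matrix_unit_nonzero [simp]: "matrix_unit i j \<noteq> 0"
proof
  assume "matrix_unit i j = (0 :: 'a cmat)"
  then have "matrix_unit i j $ i $ j = (0 :: 'a cmat) $ i $ j" by simp
  then show False by simp
qed

lemma zero_neq_matrix_unit [simp]: "0 \<noteq> matrix_unit i j"
  using matrix_unit_nonzero by metis

lemma matrix_unit_in_supported_on [simp]: "matrix_unit i j \<in> supported_on S \<longleftrightarrow> (i, j) \<in> S"
  by (auto simp: supported_on_def)

lemma matrix_eq_sum_units: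
  assumes "A \<in> supported_on S"
  shows "A = (\<Sum>(i, j)\<in>S. mscale (A $ i $ j) (matrix_unit i j))"
proof -
  have "(\<Sum>(i, j)\<in>S. mscale (A $ i $ j) (matrix_unit i j)) $ k $ l = A $ k $ l" for k l
  proof -
    have "(\<Sum>(i, j)\<in>S. mscale (A $ i $ j) (matrix_unit i j)) $ k $ l
        = (\<Sum>p\<in>S. if p = (k, l) then A $ k $ l else 0)"
      unfolding sum_component by (intro sum.cong) (auto split: if_splits)
    also have "\<dots> = A $ k $ l"
      using supported_onD[OF assms, of k l] by simp
    finally show ?thesis .
  qed
  then show ?thesis by (simp add: vec_eq_iff)
qed

lemma subspace_supported_on: "mat_vs.subspace (supported_on S)"
proof (rule mat_vs.subspaceI)
  fix x y assume x: "x \<in> supported_on S" and y: "y \<in> supported_on S"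
  show "x + y \<in> supported_on S"
    using supported_onD[OF x] supported_onD[OF y] by (fastforce simp: supported_on_def)
qed (auto simp: supported_on_def)

text \<open>Serves to bound a subspace from below: a matrix is the sum of its entries times matrix
  units, so the units can be treated one at a time.\<close>

lemma subspace_contains_supported_on:
  assumes "mat_vs.subspace T" and "\<And>i j. (i, j) \<in> S \<Longrightarrow> matrix_unit i j \<in> T"
  shows "supported_on S \<subseteq> T"
proof
  fix A assume "A \<in> supported_on S"
  then have "A = (\<Sum>(i, j)\<in>S. mscale (A $ i $ j) (matrix_unit i j))"
    by (rule matrix_eq_sum_units)
  also have "\<dots> \<in> T"
    using assms by (intro mat_vs.subspace_sum) (auto intro: mat_vs.subspace_scale)
  finally show "A \<in> T" .
qed

lemma span_matrix_units:
  "mat_vs.span ((\<lambda>(i, j). matrix_unit i j) ` S) = supported_on S"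
proof (rule mat_vs.span_unique)
  show "supported_on S \<subseteq> T"
    if "(\<lambda>(i, j). matrix_unit i j) ` S \<subseteq> T" "mat_vs.subspace T" for T
    using that by (intro subspace_contains_supported_on) auto
qed (auto simp: subspace_supported_on)

lemma supported_on_UNIV: "supported_on UNIV = UNIV"
  by (auto simp: supported_on_def)

lemma supported_on_mult:
  assumes A: "A \<in> supported_on S" and B: "B \<in> supported_on T"
    and ST: "\<And>i k j. (i, k) \<in> S \<Longrightarrow> (k, j) \<in> T \<Longrightarrow> (i, j) \<in> U"
  shows "A ** B \<in> supported_on U"
proof -
  have "(A ** B) $ i $ j = 0" if "(i, j) \<notin> U" for i j
  proof -
    have "(i, k) \<notin> S \<or> (k, j) \<notin> T" for k using ST that by blast
    then have "A $ i $ k * B $ k $ j = 0" for k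
      using supported_onD[OF A, of i k] supported_onD[OF B, of k j] by (cases "(i, k) \<in> S") auto
    then show ?thesis unfolding matrix_mult_nth by (intro sum.neutral) blast
  qed
  then show ?thesis by (auto simp: supported_on_def)
qed

lemma trace_mult_matrix_unit: "trace (A ** matrix_unit j i) = A $ i $ j"
proof -
  have "(\<Sum>k\<in>UNIV. A $ m $ k * (if k = j \<and> m = i then 1 else 0))
      = (if m = i then A $ i $ j else 0)" for m
  proof -
    have "(\<Sum>k\<in>UNIV. A $ m $ k * (if k = j \<and> m = i then 1 else 0))
        = (\<Sum>k\<in>UNIV. if k = j then (if m = i then A $ i $ j else 0) else 0)"
      by (rule sum.cong) auto
    then show ?thesis by simp
  qed
  then show ?thesis by (simp add: trace_def matrix_mult_nth)
qed

lemma trace_mscale: "trace (mscale c A) = c * trace A"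
  by (simp add: trace_def sum_distrib_left)

lemma mscale_matrix_mult: "mscale c A ** B = mscale c (A ** B)"
  and matrix_mult_mscale: "A ** mscale c B = mscale c (A ** B)"
  by (simp_all add: vec_eq_iff matrix_mult_nth sum_distrib_left algebra_simps)

lemma trace_diagonal_mult:
  fixes A B :: "'n::finite cmat"
  assumes "A \<in> supported_on Id"
  shows "trace (A ** B) = (\<Sum>i\<in>UNIV. A $ i $ i * B $ i $ i)"
proof -
  have "(\<Sum>k\<in>UNIV. A $ i $ k * B $ k $ i) = A $ i $ i * B $ i $ i" for i
  proof -
    have "(\<Sum>k\<in>UNIV. A $ i $ k * B $ k $ i) = (\<Sum>k\<in>UNIV. if k = i then A $ i $ i * B $ i $ i else 0)"
      using supported_onD[OF assms] by (intro sum.cong) auto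
    then show ?thesis by simp
  qed
  then show ?thesis by (simp add: trace_def matrix_mult_nth)
qed


section \<open>The triple in coordinates\<close>

text \<open>Abstract form of the partition of the indices into consecutive blocks.
  \<open>convex\<close> speaks only of the left part of an interval; the right part follows by
  \<open>sym\<close> and \<open>trans\<close>.\<close>

locale convex_equivalence =
  fixes E :: "'n::linorder \<Rightarrow> 'n \<Rightarrow> bool"
  assumes refl: "E i i"
    and sym: "E i j \<Longrightarrow> E j i"
    and trans: "E i j \<Longrightarrow> E j k \<Longrightarrow> E i k"
    and convex: "i \<le> j \<Longrightarrow> j \<le> k \<Longrightarrow> E i k \<Longrightarrow> E i j"
begin

text \<open>Positions of block upper triangular matrices; the converse relation gives the block
  lower triangular ones.\<close>

definition up :: "('n \<times> 'n) set" where
  "up = {(i, j). i < j \<or> E i j}"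

lemma up_trans:
  assumes "(i, k) \<in> up" "(k, j) \<in> up" shows "(i, j) \<in> up"
proof (rule ccontr)
  assume "(i, j) \<notin> up"
  then have "j \<le> i" "\<not> E i j" by (auto simp: up_def)
  then consider "i < k" "E k j" | "E i k" "k < j"
    using assms by (auto simp: up_def intro: trans)
  then show False
  proof cases
    case 1
    then have "E j i" using convex[of j i k] \<open>j \<le> i\<close> sym by auto
    then show False using \<open>\<not> E i j\<close> sym by blast
  next
    case 2
    then have "E k j" using convex[of k j i] \<open>j \<le> i\<close> sym by auto
    then show False using \<open>\<not> E i j\<close> 2 trans by blast
  qed
qed

text \<open>A path of admissible positions that returns to the block of \<open>i\<close> never
  leaves it. This makes the restriction of block triangular matrices to their diagonal blocks
  multiplicative.\<close>

lemma up_between: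
  assumes "(i, k) \<in> up" "(k, j) \<in> up" "E i j" shows "E i k"
proof (rule ccontr)
  assume n: "\<not> E i k"
  then have "i < k" "\<not> E k j" using assms by (auto simp: up_def intro: trans sym)
  then have "k < j" using assms by (auto simp: up_def)
  with \<open>i < k\<close> \<open>E i j\<close> n show False using convex[of i k j] by auto
qed

end

text \<open>Outside \<open>I1\<close> and \<open>I2\<close> all classes are singletons, and
  \<open>t\<close> pairs the blocks inside them. Descending chains of the relation in
  \<open>t_wf\<close> are the orbits \<open>i\<close>, \<open>t i\<close>, \<open>t (t i)\<close>,
  so its well-foundedness says that every orbit leaves \<open>I1\<close>: there are no stable
  points.\<close>

locale block_shift =
  blk1: convex_equivalence E1 + blk2: convex_equivalence E2
  for E1 E2 :: "'n::{finite,linorder} \<Rightarrow> 'n \<Rightarrow> bool" +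
  fixes I1 I2 :: "'n set" and t :: "'n \<Rightarrow> 'n"
  assumes E1_outside: "E1 i j \<Longrightarrow> i \<noteq> j \<Longrightarrow> i \<in> I1"
    and E2_outside: "E2 i j \<Longrightarrow> i \<noteq> j \<Longrightarrow> i \<in> I2"
    and t_bij: "bij_betw t I1 I2"
    and t_block: "i \<in> I1 \<Longrightarrow> j \<in> I1 \<Longrightarrow> E2 (t i) (t j) \<longleftrightarrow> E1 i j"
    and t_mono: "i \<in> I1 \<Longrightarrow> E1 i j \<Longrightarrow> i < j \<Longrightarrow> t i < t j"
    and t_wf: "wf {(t i, i) | i. i \<in> I1}"
begin

section \<open>Elementary properties of the index shift\<close>

lemma E1_I1: "E1 i j \<Longrightarrow> i \<in> I1 \<Longrightarrow> j \<in> I1"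
  using E1_outside blk1.sym by metis

lemma E2_I2: "E2 i j \<Longrightarrow> i \<in> I2 \<Longrightarrow> j \<in> I2"
  using E2_outside blk2.sym by metis

lemma t_in: "i \<in> I1 \<Longrightarrow> t i \<in> I2"
  using t_bij by (auto simp: bij_betw_def)

lemma t_preimage: "j \<in> I2 \<Longrightarrow> \<exists>i\<in>I1. t i = j"
  using t_bij by (auto simp: bij_betw_def)

lemma t_inj: "i \<in> I1 \<Longrightarrow> j \<in> I1 \<Longrightarrow> t i = t j \<longleftrightarrow> i = j"
  using t_bij by (auto simp: bij_betw_def inj_on_def)

lemma t_less:
  assumes "i \<in> I1" "E1 i j" shows "t i < t j \<longleftrightarrow> i < j"
proof -
  have "t j < t i" if "j < i" using t_mono[of j i] that assms E1_I1 blk1.sym by blast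
  with assms t_mono[of i j] show ?thesis by (metis less_asym neq_iff)
qed

lemma forward_induct:
  assumes "\<And>i. (i \<in> I1 \<Longrightarrow> P (t i)) \<Longrightarrow> P i"
  shows "P i"
  using t_wf by (induction i) (auto intro: assms)

text \<open>On a finite index set the converse of an acyclic relation is well-founded too. The base
  cases are the indices outside \<open>I2\<close>, which have no preimage in
  \<open>I1\<close>.\<close>

lemma backward_induct:
  assumes "\<And>i. (\<And>j. j \<in> I1 \<Longrightarrow> t j = i \<Longrightarrow> P j) \<Longrightarrow> P i"
  shows "P i"
proof -
  let ?r = "{(t i, i) | i. i \<in> I1}"
  have "wf (?r\<inverse>)"
    using t_wf by (intro finite_acyclic_wf_converse wf_acyclic) simp
  then show ?thesis by (induction i) (auto intro: assms)
qed

text \<open>Common carrier of \<open>D\<close> and \<open>N\<^sub>+\<close>: the former is cut out by \<open>b = c\<close>, the latter by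
  the vanishing of the diagonal of \<open>b\<close> outside \<open>I1\<close>.\<close>

definition Q :: "('n cmat \<times> 'n cmat \<times> 'n cmat) set" where
  "Q = {(y, b, c). y \<in> supported_on (Id_on (- I2)) \<and> b \<in> supported_on blk1.up \<and>
     c \<in> supported_on (blk2.up\<inverse>) \<and> (\<forall>i. i \<notin> I2 \<longrightarrow> c $ i $ i = y $ i $ i) \<and>
     (\<forall>i j. i \<in> I1 \<longrightarrow> E1 i j \<longrightarrow> c $ t i $ t j = b $ i $ j)}"

definition Np where "Np = {(y, b, c) \<in> Q. \<forall>i. i \<notin> I1 \<longrightarrow> b $ i $ i = 0}"

definition D where "D = {(y, b, c) \<in> Q. b = c}"

lemma in_QD:
  assumes "(y, b, c) \<in> Q"
  shows "\<And>i j. i \<noteq> j \<or> i \<in> I2 \<Longrightarrow> y $ i $ j = 0" "\<And>i j. (i, j) \<notin> blk1.up \<Longrightarrow> b $ i $ j = 0"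
    "\<And>i j. (j, i) \<notin> blk2.up \<Longrightarrow> c $ i $ j = 0" "\<And>i. i \<notin> I2 \<Longrightarrow> c $ i $ i = y $ i $ i"
    "\<And>i j. i \<in> I1 \<Longrightarrow> E1 i j \<Longrightarrow> c $ t i $ t j = b $ i $ j"
  using assms by (auto simp: Q_def elim!: supported_onD)

text \<open>By \<open>up_between\<close> every term whose middle index lies outside the block
  contains a zero factor.\<close>

lemma b_mult_block:
  assumes b: "b \<in> supported_on blk1.up" and b': "b' \<in> supported_on blk1.up" and E: "E1 i j"
  shows "(b ** b') $ i $ j = (\<Sum>k | E1 i k. b $ i $ k * b' $ k $ j)"
  unfolding matrix_mult_nth
proof (rule sum.mono_neutral_right)
  show "\<forall>k\<in>UNIV - {k. E1 i k}. b $ i $ k * b' $ k $ j = 0"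
  proof
    fix k assume "k \<in> UNIV - {k. E1 i k}"
    then have "(i, k) \<notin> blk1.up \<or> (k, j) \<notin> blk1.up" using blk1.up_between E by blast
    then show "b $ i $ k * b' $ k $ j = 0"
      using supported_onD[OF b, of i k] supported_onD[OF b', of k j] by auto
  qed
qed auto

lemma c_mult_block:
  assumes c: "c \<in> supported_on (blk2.up\<inverse>)" and c': "c' \<in> supported_on (blk2.up\<inverse>)" and E: "E2 i j"
  shows "(c ** c') $ i $ j = (\<Sum>k | E2 i k. c $ i $ k * c' $ k $ j)"
  unfolding matrix_mult_nth
proof (rule sum.mono_neutral_right)
  show "\<forall>k\<in>UNIV - {k. E2 i k}. c $ i $ k * c' $ k $ j = 0"
  proof
    fix k assume "k \<in> UNIV - {k. E2 i k}"
    then have "\<not> E2 j k" using E blk2.trans by blast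
    \<comment> \<open>Positions of lower triangular matrices are read backwards, from
      \<open>j\<close> over \<open>k\<close> to \<open>i\<close>.\<close>
    then have "(k, i) \<notin> blk2.up \<or> (j, k) \<notin> blk2.up"
      using blk2.up_between[of j k i] E blk2.sym by blast
    then show "c $ i $ k * c' $ k $ j = 0"
      using supported_onD[OF c, of i k] supported_onD[OF c', of k j] by auto
  qed
qed auto

lemma block_image:
  assumes "i \<in> I1" shows "{l. E2 (t i) l} = t ` {k. E1 i k}"
proof
  show "{l. E2 (t i) l} \<subseteq> t ` {k. E1 i k}"
  proof
    fix l assume "l \<in> {l. E2 (t i) l}"
    then have "E2 (t i) l" by simp
    then have "l \<in> I2" using E2_I2 t_in assms by blast
    then obtain k where "k \<in> I1" "t k = l" using t_preimage by blast
    then show "l \<in> t ` {k. E1 i k}" using \<open>E2 (t i) l\<close> t_block assms by blast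
  qed
  show "t ` {k. E1 i k} \<subseteq> {l. E2 (t i) l}" using t_block E1_I1 assms by blast
qed

lemma diag_mult_b:
  assumes "b \<in> supported_on blk1.up" "b' \<in> supported_on blk1.up" "i \<notin> I1"
  shows "(b ** b') $ i $ i = b $ i $ i * b' $ i $ i"
proof -
  have "{k. E1 i k} = {i}" using E1_outside assms(3) blk1.refl by blast
  then show ?thesis using b_mult_block[OF assms(1,2) blk1.refl[of i]] by simp
qed

lemma diag_mult_c:
  assumes "c \<in> supported_on (blk2.up\<inverse>)" "c' \<in> supported_on (blk2.up\<inverse>)" "i \<notin> I2"
  shows "(c ** c') $ i $ i = c $ i $ i * c' $ i $ i"
proof -
  have "{k. E2 i k} = {i}" using E2_outside assms(3) blk2.refl by blast
  then show ?thesis using c_mult_block[OF assms(1,2) blk2.refl[of i]] by simp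
qed

lemma diag_mult_y:
  assumes "y \<in> supported_on Id"
  shows "(y ** y') $ i $ j = y $ i $ i * y' $ i $ j"
proof -
  have "(\<Sum>k\<in>UNIV. y $ i $ k * y' $ k $ j) = (\<Sum>k\<in>UNIV. if k = i then y $ i $ i * y' $ i $ j else 0)"
    using supported_onD[OF assms] by (intro sum.cong) auto
  then show ?thesis by (simp add: matrix_mult_nth)
qed

text \<open>Block triangularity is preserved by products. The gluing of \<open>b\<close> and
  \<open>c\<close> survives because block entries of a product are computed inside the block, and
  \<open>t\<close> maps blocks onto blocks.\<close>

lemma Q_mult:
  assumes p: "(y, b, c) \<in> Q" and q: "(y', b', c') \<in> Q"
  shows "(y ** y', b ** b', c ** c') \<in> Q"
  unfolding Q_def mem_Collect_eq case_prod_conv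
proof (intro conjI allI impI)
  have y: "y \<in> supported_on (Id_on (- I2))" "y' \<in> supported_on (Id_on (- I2))"
    and b: "b \<in> supported_on blk1.up" "b' \<in> supported_on blk1.up"
    and c: "c \<in> supported_on (blk2.up\<inverse>)" "c' \<in> supported_on (blk2.up\<inverse>)"
    using p q by (auto simp: Q_def)
  show "y ** y' \<in> supported_on (Id_on (- I2))"
    using y by (rule supported_on_mult) auto
  show "b ** b' \<in> supported_on blk1.up"
    using b by (rule supported_on_mult) (rule blk1.up_trans)
  show "c ** c' \<in> supported_on (blk2.up\<inverse>)"
    using c by (rule supported_on_mult) (auto intro: blk2.up_trans)
  have "y \<in> supported_on Id" using y by (auto simp: supported_on_def)
  then show "(c ** c') $ i $ i = (y ** y') $ i $ i" if "i \<notin> I2" for i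
    using that by (simp add: diag_mult_c[OF c] diag_mult_y in_QD(4)[OF p] in_QD(4)[OF q])
  show "(c ** c') $ t i $ t j = (b ** b') $ i $ j" if "i \<in> I1" "E1 i j" for i j
  proof -
    have "E2 (t i) (t j)" using that t_block E1_I1 by blast
    then have "(c ** c') $ t i $ t j = (\<Sum>l | E2 (t i) l. c $ t i $ l * c' $ l $ t j)"
      by (rule c_mult_block[OF c])
    also have "\<dots> = (\<Sum>k | E1 i k. c $ t i $ t k * c' $ t k $ t j)"
    proof -
      have "inj_on t {k. E1 i k}"
        using t_inj E1_I1 that by (intro inj_onI) blast
      then show ?thesis by (simp add: block_image[OF that(1)] sum.reindex)
    qed
    also have "\<dots> = (\<Sum>k | E1 i k. b $ i $ k * b' $ k $ j)"
    proof (rule sum.cong)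
      fix k assume "k \<in> {k. E1 i k}"
      then have "E1 i k" "E1 k j" "k \<in> I1" using that E1_I1 blk1.sym blk1.trans by blast+
      then show "c $ t i $ t k * c' $ t k $ t j = b $ i $ k * b' $ k $ j"
        using in_QD(5)[OF p] in_QD(5)[OF q] that by simp
    qed simp
    also have "\<dots> = (b ** b') $ i $ j"
      by (rule b_mult_block[OF b that(2), symmetric])
    finally show ?thesis .
  qed
qed

lemma mult_diag_outside:
  assumes "(y, b, c) \<in> Q" "(y', b', c') \<in> Q" "i \<notin> I1"
  shows "(b ** b') $ i $ i = b $ i $ i * b' $ i $ i"
  using assms by (intro diag_mult_b) (auto simp: Q_def)

lemma Q_subspace:
  shows "(0, 0, 0) \<in> Q"
    and "(y, b, c) \<in> Q \<Longrightarrow> (y', b', c') \<in> Q \<Longrightarrow> (y + y', b + b', c + c') \<in> Q"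
    and "(y, b, c) \<in> Q \<Longrightarrow> (mscale r y, mscale r b, mscale r c) \<in> Q"
  by (auto simp: Q_def intro!: mat_vs.subspace_0 mat_vs.subspace_add mat_vs.subspace_scale
      subspace_supported_on)

text \<open>An off-diagonal entry is moved along \<open>t\<close>, in the direction in which its
  position stays constrained, until it leaves the blocks and must vanish.\<close>

lemma D_diagonal:
  assumes "(y, x, x) \<in> Q" shows "x \<in> supported_on Id"
proof -
  \<comment> \<open>As third component, \<open>x\<close> vanishes above the diagonal off the
    \<open>E2\<close> blocks; inside one, the entry equals the one at the preimages, so the
    induction runs backwards.\<close>
  have up: "\<forall>j>i. x $ i $ j = 0" for i
  proof (induction i rule: backward_induct)
    case (1 i)
    show ?case
    proof (intro allI impI)
      fix j assume "i < j"
      show "x $ i $ j = 0"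
      proof (cases "(j, i) \<in> blk2.up")
        case True
        then have E: "E2 i j" using \<open>i < j\<close> by (auto simp: blk2.up_def intro: blk2.sym)
        then have "i \<in> I2" "j \<in> I2" using E2_outside[of i j] E2_I2 \<open>i < j\<close> by auto
        then obtain k l where kl: "k \<in> I1" "l \<in> I1" "t k = i" "t l = j" using t_preimage by meson
        then have "E1 k l" using E t_block by blast
        moreover from this have "k < l" using t_less kl \<open>i < j\<close> by blast
        ultimately show ?thesis using 1 kl in_QD(5)[OF assms, of k l] by auto
      qed (use in_QD(3)[OF assms] in blast)
    qed
  qed
  \<comment> \<open>As second component, \<open>x\<close> vanishes below the diagonal off the
    \<open>E1\<close> blocks; inside one, the entry equals the one at the images under
    \<open>t\<close>.\<close>
  have low: "\<forall>j<i. x $ i $ j = 0" for i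
  proof (induction i rule: forward_induct)
    case (1 i)
    show ?case
    proof (intro allI impI)
      fix j assume "j < i"
      show "x $ i $ j = 0"
      proof (cases "(i, j) \<in> blk1.up")
        case True
        then have E: "E1 i j" using \<open>j < i\<close> by (auto simp: blk1.up_def)
        then have "i \<in> I1" using E1_outside \<open>j < i\<close> by blast
        moreover have "t j < t i" using t_less[of j i] E E1_I1 blk1.sym \<open>i \<in> I1\<close> \<open>j < i\<close> by blast
        ultimately show ?thesis using 1 E in_QD(5)[OF assms, of i j] by auto
      qed (use in_QD(2)[OF assms] in blast)
    qed
  qed
  show ?thesis using up low by (auto simp: supported_on_def) (metis neq_iff)
qed

text \<open>The diagonal entries are constant along \<open>t\<close> and vanish once the chain has
  left \<open>I1\<close>. Then \<open>y\<close> vanishes, since outside \<open>I2\<close> its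
  diagonal is that of \<open>x\<close>.\<close>

lemma Np_diagonal_zero:
  assumes "(y, x, x) \<in> Np" shows "x = 0" "y = 0"
proof -
  have Q: "(y, x, x) \<in> Q" and out: "\<And>i. i \<notin> I1 \<Longrightarrow> x $ i $ i = 0" using assms by (auto simp: Np_def)
  have "x $ i $ i = 0" for i
  proof (induction i rule: forward_induct)
    case (1 i)
    then show ?case using out[of i] in_QD(5)[OF Q, of i i] blk1.refl by (cases "i \<in> I1") auto
  qed
  with D_diagonal[OF Q] show "x = 0" by (auto simp: vec_eq_iff supported_on_def)
  then have "y $ i $ j = 0" for i j
    using in_QD(1)[OF Q, of i j] in_QD(4)[OF Q, of i] by (cases "i = j \<and> i \<notin> I2") auto
  then show "y = 0" by (simp add: vec_eq_iff)
qed

section \<open>Differences of the two matrix components of \<open>Np\<close>\<close>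

lemma Np_unitI1:
  assumes "i < j" "\<not> E1 i j" shows "(0, matrix_unit i j, 0) \<in> Np"
  using assms by (auto simp: Np_def Q_def supported_on_def blk1.up_def)

lemma Np_unitI2:
  assumes "j < i" "\<not> E2 i j" shows "(0, 0, matrix_unit i j) \<in> Np"
proof -
  have "\<not> E2 j i" using assms blk2.sym by blast
  \<comment> \<open>A gluing condition at this position would put \<open>i\<close> and
    \<open>j\<close> into one \<open>E2\<close> block, so no partner entry in the second component
    is forced.\<close>
  moreover have False if "k \<in> I1" "E1 k l" "t k = i" "t l = j" for k l
    using that assms t_block E1_I1 by blast
  ultimately show ?thesis
    using assms by (auto simp: Np_def Q_def supported_on_def blk2.up_def)
qed

lemma Np_unitI3:
  assumes "i \<in> I1" "E1 i j" shows "(0, matrix_unit i j, matrix_unit (t i) (t j)) \<in> Np"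
proof -
  have "E2 (t i) (t j)" "j \<in> I1" using assms t_block E1_I1 by blast+
  moreover have "t k = t i \<longleftrightarrow> k = i" "t l = t j \<longleftrightarrow> l = j" if "k \<in> I1" "E1 k l" for k l
    using that \<open>j \<in> I1\<close> assms t_inj E1_I1 by blast+
  ultimately show ?thesis
    using assms by (auto simp: Np_def Q_def supported_on_def blk1.up_def blk2.up_def t_in
        intro: blk2.sym)
qed

lemma Np_unitI4:
  assumes "i \<notin> I2" shows "(matrix_unit i i, 0, matrix_unit i i) \<in> Np"
  using assms t_in by (auto simp: Np_def Q_def supported_on_def blk2.up_def blk2.refl)

lemma Np_subspace:
  shows "(0, 0, 0) \<in> Np"
    and "(y, b, c) \<in> Np \<Longrightarrow> (y', b', c') \<in> Np \<Longrightarrow> (y + y', b + b', c + c') \<in> Np"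
    and "(y, b, c) \<in> Np \<Longrightarrow> (mscale r y, mscale r b, mscale r c) \<in> Np"
  using Q_subspace by (auto simp: Np_def)

text \<open>Modulo the differences, a block unit may be replaced by its shift along
  \<open>t\<close>. Shifting ends at a unit that is a difference, up to sign, by
  \<open>Np_unitI1\<close>, \<open>Np_unitI2\<close> or \<open>Np_unitI4\<close>.\<close>

lemma Np_difference_surj: "\<exists>y b c. (y, b, c) \<in> Np \<and> a = b - c"
proof -
  define V where "V = {b - c | y b c. (y, b, c) \<in> Np}"
  have V: "mat_vs.subspace V"
  proof (rule mat_vs.subspaceI)
    show "0 \<in> V" unfolding V_def using Np_subspace(1) by force
  next
    fix x x' assume "x \<in> V" "x' \<in> V"
    then obtain y b c y' b' c' where *: "(y, b, c) \<in> Np" "(y', b', c') \<in> Np" "x = b - c" "x' = b' - c'"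
      unfolding V_def by blast
    then have "x + x' = (b + b') - (c + c')" by simp
    then show "x + x' \<in> V" unfolding V_def using Np_subspace(2)[OF *(1,2)] by blast
  next
    fix r x assume "x \<in> V"
    then obtain y b c where *: "(y, b, c) \<in> Np" "x = b - c" unfolding V_def by blast
    then have "mscale r x = mscale r b - mscale r c" by (simp add: mat_vs.scale_right_diff_distrib)
    then show "mscale r x \<in> V" unfolding V_def using Np_subspace(3)[OF *(1)] by blast
  qed
  have VI: "b - c \<in> V" if "(y, b, c) \<in> Np" for y b c using that by (auto simp: V_def)
  have neg: "- x \<in> V" if "x \<in> V" for x using that mat_vs.subspace_neg[OF V] by blast
  have shift: "matrix_unit i j - matrix_unit (t i) (t j) \<in> V" if "i \<in> I1" "E1 i j" for i j
    using VI[OF Np_unitI3[OF that]] .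
  \<comment> \<open>Units above the diagonal are free in \<open>b\<close> off the \<open>E1\<close>
    blocks, so they are pushed forward along \<open>t\<close>.\<close>
  have up: "\<forall>j>i. matrix_unit i j \<in> V" for i
  proof (induction i rule: forward_induct)
    case (1 i)
    show ?case
    proof (intro allI impI)
      fix j assume "i < j"
      show "matrix_unit i j \<in> V"
      proof (cases "E1 i j")
        case True
        then have "i \<in> I1" using E1_outside \<open>i < j\<close> by blast
        then have "matrix_unit (t i) (t j) \<in> V" using 1 t_mono True \<open>i < j\<close> by blast
        from mat_vs.subspace_add[OF V shift[OF \<open>i \<in> I1\<close> True] this] show ?thesis by simp
      next
        case False
        then show ?thesis using VI[OF Np_unitI1] \<open>i < j\<close> by fastforce
      qed
    qed
  qed
  \<comment> \<open>The diagonal belongs to the backward half: the diagonal of \<open>b\<close> is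
    zero outside \<open>I1\<close>, whereas \<open>Np_unitI4\<close> supplies diagonal units in
    \<open>c\<close> outside \<open>I2\<close>.\<close>
  have low: "\<forall>j\<le>i. matrix_unit i j \<in> V" for i
  proof (induction i rule: backward_induct)
    case (1 i)
    show ?case
    proof (intro allI impI)
      fix j assume "j \<le> i"
      consider "\<not> E2 i j" | "i \<notin> I2" "E2 i j" | "i \<in> I2" "E2 i j" by blast
      then show "matrix_unit i j \<in> V"
      proof cases
        case 1
        then have "j < i" using \<open>j \<le> i\<close> blk2.refl by (metis order_le_less)
        then show ?thesis using neg[OF VI[OF Np_unitI2]] 1 by fastforce
      next
        case 2
        then have "j = i" using E2_outside by blast
        then show ?thesis using neg[OF VI[OF Np_unitI4[OF 2(1)]]] by simp
      next
        case 3
        then have "j \<in> I2" using E2_I2 by blast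
        then obtain k l where kl: "k \<in> I1" "l \<in> I1" "t k = i" "t l = j" using 3 t_preimage by meson
        then have E: "E1 k l" using 3 t_block by blast
        have "l \<le> k" using t_less[OF kl(1) E] kl \<open>j \<le> i\<close> by auto
        then have "matrix_unit k l \<in> V" using "1" kl by blast
        from mat_vs.subspace_diff[OF V this shift[OF kl(1) E]] show ?thesis by (simp add: kl)
      qed
    qed
  qed
  have "matrix_unit i j \<in> V" for i j using up low by (cases "i < j") auto
  then have "supported_on UNIV \<subseteq> V" using V by (intro subspace_contains_supported_on)
  then have "a \<in> V" by (auto simp: supported_on_UNIV)
  then show ?thesis unfolding V_def by blast
qed

text \<open>The values of \<open>y\<close> are prescribed at the indices outside \<open>I2\<close>,
  where the chains of \<open>t\<close> start, and are spread as constants along these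
  chains.\<close>

lemma D_extend:
  assumes "y \<in> supported_on (Id_on (- I2))"
  shows "\<exists>x. (y, x, x) \<in> D"
proof -
  define s where "s = {(i, t i) | i. i \<in> I1}"
  \<comment> \<open>The sum ranges over the starting points from which \<open>i\<close> is reached;
    summing avoids having to choose the start of the chain.\<close>
  define x :: "'n cmat" where
    "x = (\<chi> i j. if i = j then (\<Sum>r | r \<notin> I2 \<and> (r, i) \<in> s\<^sup>*. y $ r $ r) else 0)"
  have "{r. r \<notin> I2 \<and> (r, i) \<in> s\<^sup>*} = {i}" if "i \<notin> I2" for i
    using that t_in by (auto simp: s_def elim: rtranclE)
  then have x_out: "x $ i $ i = y $ i $ i" if "i \<notin> I2" for i using that by (simp add: x_def)
  \<comment> \<open>Since \<open>t\<close> is injective on \<open>I1\<close>, the last step of a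
    chain arriving at \<open>t i\<close> comes from \<open>i\<close>, so both indices have the same
    starting points.\<close>
  have "r \<notin> I2 \<and> (r, t i) \<in> s\<^sup>* \<longleftrightarrow> r \<notin> I2 \<and> (r, i) \<in> s\<^sup>*" if "i \<in> I1" for i r
  proof -
    have "(i, t i) \<in> s" using that by (auto simp: s_def)
    moreover have "(r, i) \<in> s\<^sup>*" if r: "r \<notin> I2" "(r, t i) \<in> s\<^sup>*"
      using r(2)
    proof (cases rule: rtranclE)
      case base
      then show ?thesis using r t_in \<open>i \<in> I1\<close> by blast
    next
      case (step k)
      then have "k = i" using t_inj \<open>i \<in> I1\<close> by (auto simp: s_def)
      then show ?thesis using step by simp
    qed
    ultimately show ?thesis by (meson rtrancl.rtrancl_into_rtrancl)
  qed
  then have "x $ t i $ t i = x $ i $ i" if "i \<in> I1" for i using that by (simp add: x_def)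
  moreover have "x $ i $ j = 0" if "i \<noteq> j" for i j using that by (simp add: x_def)
  moreover have "x \<in> supported_on blk1.up" "x \<in> supported_on (blk2.up\<inverse>)"
    by (auto simp: supported_on_def x_def blk1.up_def blk2.up_def intro: blk1.refl blk2.refl)
  ultimately have "(y, x, x) \<in> Q"
    unfolding Q_def using assms x_out t_inj E1_I1 by auto metis
  then show ?thesis by (auto simp: D_def)
qed

end

section \<open>The axioms of an associative triple in coordinates\<close>

lemma mat3_scale [simp]: "mat3_vs.scale r (y, a, b) = (mscale r y, mscale r a, mscale r b)"
  by (simp add: mat3_vs.scale_def mat2_vs.scale_def)

lemma mult3_simp [simp]: "mult3 (y, a, b) (y', a', b') = (y ** y', a ** a', b ** b')"
  by (simp add: mult3_def)

lemma form_M_simp: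
  "form_M (y, a, b) (y', a', b') = trace (y ** y') + trace (a ** a') - trace (b ** b')"
  by (simp add: form_M_def trace_M_def)

lemma trace_zero [simp]: "trace (0 :: 'n::finite cmat) = 0"
  by (simp add: trace_def)

lemma mat_eq_0_if_trace_mult_zero:
  assumes "\<And>i j. trace (A ** matrix_unit i j) = 0" shows "A = 0"
  using assms by (simp add: trace_mult_matrix_unit vec_eq_iff)

lemma zero_in_supported_on [simp]: "0 \<in> supported_on S"
  by (simp add: supported_on_def)

lemma matrix_mult_add_left: "((A :: 'n::finite cmat) + B) ** C = A ** C + B ** C"
  by (simp add: vec_eq_iff matrix_mult_nth sum.distrib algebra_simps)

lemma matrix_mult_diff_left: "((A :: 'n::finite cmat) - B) ** C = A ** C - B ** C"
  by (simp add: vec_eq_iff matrix_mult_nth sum_subtractf left_diff_distrib)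

context block_shift
begin

abbreviation M :: "('n cmat \<times> 'n cmat \<times> 'n cmat) set" where
  "M \<equiv> supported_on (Id_on (- I2)) \<times> UNIV \<times> UNIV"

lemma M_finite_dim: "\<exists>S. finite S \<and> S \<subseteq> M \<and> M \<subseteq> mat3_vs.p.span S"
proof (intro exI conjI)
  let ?U = "\<lambda>S :: ('n \<times> 'n) set. (\<lambda>(i, j). matrix_unit i j) ` S"
  let ?S = "?U (Id_on (- I2)) \<times> {0} \<union> {0} \<times> (?U UNIV \<times> {0}) \<union> {0} \<times> ({0} \<times> ?U UNIV)"
  show "finite ?S" by simp
  show "?S \<subseteq> M" by auto
  show "M \<subseteq> mat3_vs.p.span ?S"
  proof
    fix x :: "'n cmat \<times> 'n cmat \<times> 'n cmat" assume "x \<in> M"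
    then obtain y a b where x: "x = (y, a, b)" and y: "y \<in> supported_on (Id_on (- I2))" by auto
    have "(y, 0) \<in> mat3_vs.p.span (?U (Id_on (- I2)) \<times> {0})"
      using y by (simp add: mat3_vs.span_Times_sing2 span_matrix_units)
    moreover have "(0, (a, 0)) \<in> mat3_vs.p.span ({0} \<times> (?U UNIV \<times> {0}))"
      unfolding mat3_vs.span_Times_sing1 mat2_vs.span_Times_sing2 span_matrix_units supported_on_UNIV
      by simp
    moreover have "(0, (0, b)) \<in> mat3_vs.p.span ({0} \<times> ({0} \<times> ?U UNIV))"
      unfolding mat3_vs.span_Times_sing1 mat2_vs.span_Times_sing1 span_matrix_units supported_on_UNIV
      by simp
    ultimately have "(y, 0) \<in> mat3_vs.p.span ?S" "(0, (a, 0)) \<in> mat3_vs.p.span ?S"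
      "(0, (0, b)) \<in> mat3_vs.p.span ?S"
      by - (erule subsetD[OF mat3_vs.p.span_mono, rotated]; blast)+
    then have "(y, 0) + (0, (a, 0)) + (0, (0, b)) \<in> mat3_vs.p.span ?S"
      by (intro mat3_vs.p.span_add)
    then show "x \<in> mat3_vs.p.span ?S" by (simp add: x zero_prod_def)
  qed
qed

lemma M_algebra: "fd_unital_algebra mat3_vs.scale mult3 M"
proof (unfold_locales, goal_cases)
  case 1
  show ?case
    by (auto intro!: mat3_vs.p.subspaceI mat_vs.subspace_add mat_vs.subspace_scale
        subspace_supported_on simp: zero_prod_def)
next
  case 2
  show ?case by (rule M_finite_dim)
next
  case (3 x y)
  then show ?case by (auto intro: supported_on_mult)
next
  case 9
  \<comment> \<open>The unit of the first summand is not the identity matrix but the projection onto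
    the indices outside \<open>I2\<close>.\<close>
  define e :: "'n cmat" where "e = (\<chi> i j. if i = j \<and> i \<notin> I2 then 1 else 0)"
  have "e ** y = y \<and> y ** e = y" if y: "y \<in> supported_on (Id_on (- I2))" for y
  proof -
    have y0: "y $ i $ j = 0" if "i \<noteq> j \<or> i \<in> I2 \<or> j \<in> I2" for i j
      using that supported_onD[OF y, of i j] by auto
    have *: "(\<Sum>k\<in>UNIV. e $ i $ k * y $ k $ j) = (\<Sum>k\<in>UNIV. if k = i then y $ i $ j else 0)"
      "(\<Sum>k\<in>UNIV. y $ i $ k * e $ k $ j) = (\<Sum>k\<in>UNIV. if k = j then y $ i $ j else 0)" for i j
      by (intro sum.cong; auto simp: e_def y0)+
    show ?thesis unfolding vec_eq_iff matrix_mult_nth * by simp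
  qed
  moreover have "e \<in> supported_on (Id_on (- I2))" by (auto simp: supported_on_def e_def)
  ultimately show ?case
    by (intro bexI[of _ "(e, mat 1, mat 1)"]) auto
next
  case (4 x y z)
  show ?case by (cases x; cases y; cases z) (simp add: matrix_mult_add_left)
next
  case (5 x y z)
  show ?case by (cases x; cases y; cases z) (simp add: matrix_add_ldistrib)
next
  case (6 x y c)
  show ?case by (cases x; cases y) (simp add: mscale_matrix_mult)
next
  case (7 x y c)
  show ?case by (cases x; cases y) (simp add: matrix_mult_mscale)
next
  case (8 x y z)
  show ?case by (cases x; cases y; cases z) (simp add: matrix_mul_assoc)
qed

text \<open>\<open>Np\<close> is the kernel, inside \<open>Q\<close>, of reading off the diagonal of
  \<open>b\<close> outside \<open>I1\<close>, which is multiplicative by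
  \<open>mult_diag_outside\<close>. This yields both the subalgebra and the bimodule
  property.\<close>

lemma Q_Np_ideal:
  assumes "p \<in> Q" "q \<in> Np" shows "mult3 p q \<in> Np" "mult3 q p \<in> Np"
proof -
  obtain y b c y' b' c' where pq: "p = (y, b, c)" "q = (y', b', c')" by (metis prod.exhaust)
  then have Q: "(y, b, c) \<in> Q" "(y', b', c') \<in> Q" and 0: "\<And>i. i \<notin> I1 \<Longrightarrow> b' $ i $ i = 0"
    using assms by (auto simp: Np_def)
  show "mult3 p q \<in> Np" "mult3 q p \<in> Np"
    using Q_mult[OF Q] Q_mult[OF Q(2,1)] mult_diag_outside[OF Q] mult_diag_outside[OF Q(2,1)] 0
    by (simp_all add: pq Np_def)
qed

lemma D_mult:
  assumes "p \<in> D" "q \<in> D" shows "mult3 p q \<in> D"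
proof -
  obtain y x y' x' where pq: "p = (y, x, x)" "q = (y', x', x')" and Q: "(y, x, x) \<in> Q" "(y', x', x') \<in> Q"
    using assms by (auto simp: D_def)
  show ?thesis using Q_mult[OF Q] by (simp add: pq D_def)
qed

lemma Np_subset_Q: "Np \<subseteq> Q" and D_subset_Q: "D \<subseteq> Q"
  by (auto simp: Np_def D_def)

lemma Q_subset_M: "Q \<subseteq> M"
  by (auto simp: Q_def)

text \<open>As \<open>x\<close> and \<open>y\<close> are diagonal, only diagonal entries contribute.
  Shifted along \<open>t\<close>, the trace with \<open>b\<close> becomes the part of the trace with
  \<open>c\<close> over \<open>I2\<close>; the trace with \<open>y'\<close> supplies the part
  outside \<open>I2\<close>.\<close>

lemma D_orthogonal_Np:
  assumes d: "(y, x, x) \<in> D" and p: "(y', b, c) \<in> Np"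
  shows "form_M (y, x, x) (y', b, c) = 0"
proof -
  have Q: "(y, x, x) \<in> Q" "(y', b, c) \<in> Q" using d p by (auto simp: D_def Np_def)
  have diag: "y \<in> supported_on Id" "x \<in> supported_on Id"
    using D_diagonal[OF Q(1)] Q(1) by (auto simp: Q_def supported_on_def)
  have "(\<Sum>i\<in>UNIV. x $ i $ i * b $ i $ i) = (\<Sum>i\<in>I1. x $ i $ i * b $ i $ i)"
    using p by (intro sum.mono_neutral_right) (auto simp: Np_def)
  also have "\<dots> = (\<Sum>i\<in>I1. x $ t i $ t i * c $ t i $ t i)"
    using in_QD(5)[OF Q(1)] in_QD(5)[OF Q(2)] blk1.refl by (intro sum.cong) auto
  also have "\<dots> = (\<Sum>j\<in>I2. x $ j $ j * c $ j $ j)"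
    by (rule sum.reindex_bij_betw[OF t_bij])
  finally have b: "trace (x ** b) = (\<Sum>j\<in>I2. x $ j $ j * c $ j $ j)"
    by (simp add: trace_diagonal_mult diag)
  have "(\<Sum>i\<in>UNIV. y $ i $ i * y' $ i $ i) = (\<Sum>i\<in>-I2. y $ i $ i * y' $ i $ i)"
    using in_QD(1)[OF Q(1)] by (intro sum.mono_neutral_right) auto
  also have "\<dots> = (\<Sum>i\<in>-I2. x $ i $ i * c $ i $ i)"
    using in_QD(4)[OF Q(1)] in_QD(4)[OF Q(2)] by (intro sum.cong) auto
  finally have y: "trace (y ** y') = (\<Sum>i\<in>-I2. x $ i $ i * c $ i $ i)"
    by (simp add: trace_diagonal_mult diag)
  have "trace (x ** c) = (\<Sum>i\<in>I2. x $ i $ i * c $ i $ i) + (\<Sum>i\<in>-I2. x $ i $ i * c $ i $ i)"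
    using sum.union_disjoint[of I2 "- I2" "\<lambda>i. x $ i $ i * c $ i $ i"]
    by (simp add: trace_diagonal_mult diag Compl_partition)
  with b y show ?thesis by (simp add: form_M_simp)
qed

text \<open>An element of \<open>Np\<close> corrects the difference of the two matrix components, an
  element of \<open>D\<close> then corrects the first component, and what remains lies in
  \<open>alg_Nminus\<close>.\<close>

lemma M_decomposition: "M = alg_Nminus + D + Np"
proof
  show "M \<subseteq> alg_Nminus + D + Np"
  proof
    fix m assume "m \<in> M"
    then obtain z p q where m: "m = (z, p, q)" and z: "z \<in> supported_on (Id_on (- I2))" by auto
    obtain y b c where N: "(y, b, c) \<in> Np" and pq: "p - q = b - c"
      using Np_difference_surj by blast
    then have "y \<in> supported_on (Id_on (- I2))" by (auto simp: Np_def Q_def)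
    then have "z - y \<in> supported_on (Id_on (- I2))"
      using z mat_vs.subspace_diff[OF subspace_supported_on] by blast
    then obtain x where x: "(z - y, x, x) \<in> D" using D_extend by blast
    have "m = (0, p - x - b, p - x - b) + (z - y, x, x) + (y, b, c)"
      using pq by (simp add: m algebra_simps)
    moreover have "(0, p - x - b, p - x - b) \<in> alg_Nminus" by (simp add: alg_Nminus_def)
    ultimately show "m \<in> alg_Nminus + D + Np" using N x by (simp only: set_plus_intro)
  qed
  have "alg_Nminus \<subseteq> M" by (auto simp: alg_Nminus_def)
  then have "alg_Nminus + D + Np \<subseteq> M + M + M"
    using D_subset_Q Np_subset_Q Q_subset_M by (intro set_plus_mono2) auto
  also have "\<dots> \<subseteq> M"
    by (auto elim!: set_plus_elim intro!: mat_vs.subspace_add[OF subspace_supported_on])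
  finally show "alg_Nminus + D + Np \<subseteq> M" .
qed

lemma coordinate_triple:
  "associative_triple mat3_vs.scale mult3 M form_M
     (D + Np) (D + alg_Nminus) alg_Nminus D Np"
proof -
  interpret fd_unital_algebra mat3_vs.scale mult3 M by (rule M_algebra)
  show ?thesis
  proof (unfold_locales, goal_cases)
    case (1 x y z)
    then show ?case
      by (cases x; cases y; cases z) (simp add: form_M_simp matrix_mult_add_left trace_add)
  next
    case (2 x y c)
    then show ?case
      by (cases x; cases y) (simp add: form_M_simp mscale_matrix_mult trace_mscale algebra_simps)
  next
    case (3 x y)
    obtain x1 x2 x3 y1 y2 y3 where "x = (x1, x2, x3)" "y = (y1, y2, y3)"
      by (metis prod.exhaust)
    then show ?case
      by (simp add: form_M_simp trace_mul_sym[of x1 y1] trace_mul_sym[of x2 y2] trace_mul_sym[of x3 y3])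
  next
    case (4 x)
    obtain y a b where x: "x = (y, a, b)" and y: "y \<in> supported_on (Id_on (- I2))"
      using 4(1) by auto
    have "y $ i $ j = 0" for i j
    proof (cases "i = j \<and> i \<notin> I2")
      case True
      then show ?thesis using 4(2)[of "(matrix_unit i i, 0, 0)"]
        by (auto simp: x form_M_simp trace_mult_matrix_unit)
    qed (use supported_onD[OF y, of i j] in auto)
    moreover have "a = 0"
    proof (rule mat_eq_0_if_trace_mult_zero)
      show "trace (a ** matrix_unit i j) = 0" for i j
        using 4(2)[of "(0, matrix_unit i j, 0)"] by (simp add: x form_M_simp)
    qed
    moreover have "b = 0"
    proof (rule mat_eq_0_if_trace_mult_zero)
      show "trace (b ** matrix_unit i j) = 0" for i j
        using 4(2)[of "(0, 0, matrix_unit i j)"] by (simp add: x form_M_simp)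
    qed
    ultimately show ?case by (simp add: x zero_prod_def vec_eq_iff)
  next
    case (5 x y z)
    obtain x1 x2 x3 y1 y2 y3 z1 z2 z3 where "x = (x1, x2, x3)" "y = (y1, y2, y3)" "z = (z1, z2, z3)"
      by (metis prod.exhaust)
    moreover have "trace ((u ** v) ** w) = trace (v ** (w ** u))" for u v w :: "'n cmat"
      by (simp only: trace_mul_sym[of u] matrix_mul_assoc[symmetric])
    ultimately show ?case by (simp add: form_M_simp)
  next
    case 6
    show ?case unfolding subalgebra_def
      by (auto simp: alg_Nminus_def zero_prod_def intro!: mat3_vs.p.subspaceI)
  next
    case 7
    have "mat3_vs.p.subspace D"
      by (intro mat3_vs.p.subspaceI) (auto simp: D_def zero_prod_def intro: Q_subspace)
    then show ?case unfolding subalgebra_def using D_mult D_subset_Q Q_subset_M by blast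
  next
    case 8
    have "mat3_vs.p.subspace Np"
      by (intro mat3_vs.p.subspaceI) (auto simp: zero_prod_def intro: Np_subspace)
    then show ?case unfolding subalgebra_def using Q_Np_ideal Np_subset_Q Q_subset_M by blast
  next
    case 9
    show ?case by (rule M_decomposition)
  next
    case (10 x)
    obtain y b c where x: "x = (y, b, c)" by (cases x) auto
    \<comment> \<open>The pairing with \<open>(0, a, a)\<close> is the trace of
      \<open>(b - c) ** a\<close>.\<close>
    have "b - c = 0"
    proof (rule mat_eq_0_if_trace_mult_zero)
      show "trace ((b - c) ** matrix_unit i j) = 0" for i j
        using 10(2)[of "(0, matrix_unit i j, matrix_unit i j)"]
        by (auto simp: x form_M_simp alg_Nminus_def trace_mult_matrix_unit)
    qed
    then have "(y, b, b) \<in> Np" "c = b" using 10(1) x by auto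
    then show ?case using Np_diagonal_zero by (auto simp: x zero_prod_def)
  next
    case (11 y)
    obtain a where y: "y = (0, a, a)" using 11(1) by (auto simp: alg_Nminus_def)
    \<comment> \<open>The differences coming from \<open>Np\<close> realise every matrix unit, so
      the trace form detects \<open>a\<close>.\<close>
    have "a = 0"
    proof (rule mat_eq_0_if_trace_mult_zero)
      fix i j
      obtain z b c where N: "(z, b, c) \<in> Np" and bc: "matrix_unit i j = b - c"
        using Np_difference_surj by blast
      have "trace (b ** a) - trace (c ** a) = 0"
        using 11(2)[OF N] by (simp add: y form_M_simp)
      also have "trace (b ** a) - trace (c ** a) = trace ((b - c) ** a)"
        by (simp add: matrix_mult_diff_left trace_sub)
      finally show "trace (a ** matrix_unit i j) = 0"
        unfolding bc by (subst trace_mul_sym)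
    qed
    then show ?case by (simp add: y zero_prod_def)
  next
    case 12
    show ?case unfolding bimodule_over_def using Q_Np_ideal D_subset_Q by blast
  next
    case 13
    show ?case unfolding bimodule_over_def by (auto simp: D_def alg_Nminus_def)
  next
    case (14 d x)
    obtain y z where d: "d = (y, z, z)" using 14(1) by (auto simp: D_def)
    obtain a y' b c where x: "x = (0, a, a) + (y', b, c)" and N: "(y', b, c) \<in> Np"
      using 14(2) by (auto simp: alg_Nminus_def elim!: set_plus_elim)
    have "form_M d x = form_M (y, z, z) (y', b, c)"
      by (simp add: d x form_M_simp matrix_add_ldistrib trace_add)
    also have "\<dots> = 0" using 14(1) N d D_orthogonal_Np by blast
    finally show ?case .
  next
    case 17
    have "p \<in> D" if p: "p \<in> D + Np" "p \<in> D + alg_Nminus" for p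
    proof -
      from p(1) obtain y x y' b c where 1: "(y, x, x) \<in> D" "(y', b, c) \<in> Np" "p = (y + y', x + b, x + c)"
        by (auto simp: D_def elim!: set_plus_elim)
      from p(2) obtain z v a where 2: "(z, v, v) \<in> D" "p = (z, v + a, v + a)"
        by (auto simp: D_def alg_Nminus_def elim!: set_plus_elim)
      \<comment> \<open>The second description has equal matrix components, and so has the
        \<open>D\<close> part of the first; hence so has its \<open>Np\<close> part, which vanishes
        by \<open>Np_diagonal_zero\<close>.\<close>
      have "c = b" using 1 2 by (metis add_left_cancel prod.inject)
      then have "b = 0" "y' = 0" using 1(2) Np_diagonal_zero by blast+
      then show ?thesis using 1 \<open>c = b\<close> by simp
    qed
    then have "(D + Np) \<inter> (D + alg_Nminus) \<subseteq> D" by (intro subsetI) (elim IntE)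
    moreover have "0 \<in> Np" "0 \<in> alg_Nminus"
      using Np_subspace(1) by (simp_all add: alg_Nminus_def zero_prod_def)
    then have "D \<subseteq> (D + Np) \<inter> (D + alg_Nminus)"
      unfolding add.commute[of D] by (intro Int_greatest set_zero_plus2)
    ultimately show ?case by (rule equalityI[rotated])
  qed (rule refl)+
qed

end

section \<open>Root subsystems\<close>

definition same_block :: "('n::finite \<times> 'n) set \<Rightarrow> 'n \<Rightarrow> 'n \<Rightarrow> bool" where
  "same_block \<Gamma> i j \<longleftrightarrow> i = j \<or> (i, j) \<in> root_subsystem \<Gamma>"

definition supp :: "('n::finite \<times> 'n) set \<Rightarrow> 'n set" where
  "supp \<Gamma> = Domain (root_subsystem \<Gamma>)"

text \<open>Unlike \<open>same_block\<close>, which is reflexive at every index, this omits the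
  singletons outside \<open>supp\<close>, whose diagonal units do not lie in
  \<open>A_sub\<close>.\<close>

definition blocks :: "('n::finite \<times> 'n) set \<Rightarrow> ('n \<times> 'n) set" where
  "blocks \<Gamma> = {(i, j). i \<in> supp \<Gamma> \<and> same_block \<Gamma> i j}"

lemma root_subsystemI:
  assumes "i \<noteq> j" "\<And>h. h \<in> cartan \<Longrightarrow> root_val (i, j) h = (\<Sum>\<alpha>\<in>\<Gamma>. of_int (c \<alpha>) * root_val \<alpha> h)"
  shows "(i, j) \<in> root_subsystem \<Gamma>"
  unfolding root_subsystem_def roots_def
  using assms by (intro CollectI conjI exI[of _ c] ballI) simp_all

lemma root_subsystem_irrefl: "(i, j) \<in> root_subsystem \<Gamma> \<Longrightarrow> i \<noteq> j"
  by (simp add: root_subsystem_def roots_def)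

lemma root_subsystem_sym:
  assumes "(i, j) \<in> root_subsystem \<Gamma>" shows "(j, i) \<in> root_subsystem \<Gamma>"
proof -
  obtain c :: "'a \<times> 'a \<Rightarrow> int" where
    c: "\<And>h. h \<in> cartan \<Longrightarrow> root_val (i, j) h = (\<Sum>\<alpha>\<in>\<Gamma>. of_int (c \<alpha>) * root_val \<alpha> h)"
    using assms by (auto simp: root_subsystem_def)
  have "root_val (j, i) h = (\<Sum>\<alpha>\<in>\<Gamma>. of_int (- c \<alpha>) * root_val \<alpha> h)" if "h \<in> cartan" for h
  proof -
    have "root_val (j, i) h = - root_val (i, j) h" by (simp add: root_val_def)
    then show ?thesis by (simp add: c[OF that] sum_negf)
  qed
  with root_subsystem_irrefl[OF assms] show ?thesis by (intro root_subsystemI[where c = "\<lambda>\<alpha>. - c \<alpha>"]) auto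
qed

lemma root_subsystem_trans:
  assumes "(i, j) \<in> root_subsystem \<Gamma>" "(j, k) \<in> root_subsystem \<Gamma>" "i \<noteq> k"
  shows "(i, k) \<in> root_subsystem \<Gamma>"
proof -
  obtain c d :: "'a \<times> 'a \<Rightarrow> int" where
    c: "\<And>h. h \<in> cartan \<Longrightarrow> root_val (i, j) h = (\<Sum>\<alpha>\<in>\<Gamma>. of_int (c \<alpha>) * root_val \<alpha> h)" and
    d: "\<And>h. h \<in> cartan \<Longrightarrow> root_val (j, k) h = (\<Sum>\<alpha>\<in>\<Gamma>. of_int (d \<alpha>) * root_val \<alpha> h)"
    using assms by (auto simp: root_subsystem_def)
  have "root_val (i, k) h = (\<Sum>\<alpha>\<in>\<Gamma>. of_int (c \<alpha> + d \<alpha>) * root_val \<alpha> h)" if "h \<in> cartan" for h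
  proof -
    have "root_val (i, k) h = root_val (i, j) h + root_val (j, k) h" by (simp add: root_val_def)
    then show ?thesis by (simp add: c d that sum.distrib ring_distribs)
  qed
  with assms(3) show ?thesis by (intro root_subsystemI)
qed

lemma simple_in_root_subsystem:
  fixes \<Gamma> :: "('n::{finite,linorder} \<times> 'n) set"
  assumes "\<Gamma> \<subseteq> simple_roots" "\<alpha> \<in> \<Gamma>"
  shows "\<alpha> \<in> root_subsystem \<Gamma>"
proof -
  have "root_val \<alpha> h = (\<Sum>\<beta>\<in>\<Gamma>. of_int (if \<beta> = \<alpha> then 1 else 0) * root_val \<beta> h)" for h
  proof -
    have "(\<Sum>\<beta>\<in>\<Gamma>. of_int (if \<beta> = \<alpha> then 1 else 0) * root_val \<beta> h)
        = (\<Sum>\<beta>\<in>\<Gamma>. if \<beta> = \<alpha> then root_val \<alpha> h else 0)"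
      by (intro sum.cong) auto
    then show ?thesis using assms(2) by simp
  qed
  moreover obtain i j where "\<alpha> = (i, j)" "i \<noteq> j"
    using assms by (cases \<alpha>) (auto simp: simple_roots_def)
  ultimately show ?thesis by (auto intro: root_subsystemI)
qed

text \<open>The traceless diagonal matrix constant up to \<open>p\<close> and constant from \<open>q\<close> on is killed by every
  simple root other than \<open>(p, q)\<close>.\<close>

lemma root_subsystem_gap:
  fixes \<Gamma> :: "('n::{finite,linorder} \<times> 'n) set"
  assumes \<Gamma>: "\<Gamma> \<subseteq> simple_roots" and ij: "(i, j) \<in> root_subsystem \<Gamma>"
    and pq: "(p, q) \<in> simple_roots" "i \<le> p" "q \<le> j"
  shows "(p, q) \<in> \<Gamma>"
proof (rule ccontr)
  assume nin: "(p, q) \<notin> \<Gamma>"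
  have "p < q" using pq by (simp add: simple_roots_def)
  have gap: "k \<le> p \<or> q \<le> k" for k
  proof -
    have "\<not> (p < k \<and> k < q)" using pq by (simp add: simple_roots_def)
    then show ?thesis by (metis not_le)
  qed
  \<comment> \<open>The value on each side is, up to sign, the number of indices on the other side,
    so the trace cancels.\<close>
  define h :: "'n cmat" where
    "h = (\<chi> k l. if k \<noteq> l then 0 else if k \<le> p then of_nat (card {q..}) else - of_nat (card {..p}))"
  have "trace h = (\<Sum>k\<in>{..p} \<union> {q..}. h $ k $ k)"
    unfolding trace_def using gap by (intro sum.cong) auto
  also have "\<dots> = (\<Sum>k\<in>{..p}. h $ k $ k) + (\<Sum>k\<in>{q..}. h $ k $ k)"
    using \<open>p < q\<close> by (intro sum.union_disjoint) auto
  also have "(\<Sum>k\<in>{q..}. h $ k $ k) = (\<Sum>k\<in>{q..}. - of_nat (card {..p}))"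
    using \<open>p < q\<close> by (intro sum.cong) (auto simp: h_def)
  finally have "trace h = 0" by (simp add: h_def)
  then have h: "h \<in> cartan" by (simp add: cartan_def sl_def h_def)
  have "root_val \<alpha> h = 0" if "\<alpha> \<in> \<Gamma>" for \<alpha>
  proof -
    obtain k l where \<alpha>: "\<alpha> = (k, l)" by fastforce
    have "k < l" "\<not> (k < m \<and> m < l)" for m
      using \<Gamma> that by (auto simp: \<alpha> simple_roots_def)
    \<comment> \<open>A simple root with its ends on different sides of the gap would be
      \<open>(p, q)\<close> itself.\<close>
    then have "k \<le> p \<longleftrightarrow> l \<le> p"
      using gap[of l] gap[of k] nin that \<open>p < q\<close> unfolding \<alpha>
      by (metis antisym_conv2 leD less_imp_le order.strict_trans2 order_le_less)
    then show ?thesis by (simp add: \<alpha> root_val_def h_def)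
  qed
  then have "(\<Sum>\<alpha>\<in>\<Gamma>. of_int (c \<alpha>) * root_val \<alpha> h) = 0" for c :: "'n \<times> 'n \<Rightarrow> int"
    by (intro sum.neutral) simp
  then have "root_val (i, j) h = 0"
    using ij h by (auto simp: root_subsystem_def)
  moreover have "\<not> j \<le> p" using pq \<open>p < q\<close> by auto
  ultimately have "of_nat (card {q..}) + of_nat (card {..p}) = (0 :: complex)"
    using pq by (simp add: root_val_def h_def)
  then have "of_nat (card {q..} + card {..p}) = (0 :: complex)" by simp
  then have "card {..p} = 0" unfolding of_nat_eq_0_iff by simp
  then show False by auto
qed

text \<open>Builds a positive root from simple roots. The bounds by \<open>i\<close> and
  \<open>j\<close> are kept in the premises so that \<open>root_subsystem_gap\<close> applies to
  every simple root met on the way.\<close>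

lemma interval_induct:
  fixes i j :: "'n::{finite,linorder}"
  assumes "i < j"
    and "\<And>p q. (p, q) \<in> simple_roots \<Longrightarrow> i \<le> p \<Longrightarrow> q \<le> j \<Longrightarrow> P p q"
    and "\<And>p q r. i \<le> p \<Longrightarrow> p < q \<Longrightarrow> q < r \<Longrightarrow> r \<le> j \<Longrightarrow> P p q \<Longrightarrow> P q r \<Longrightarrow> P p r"
  shows "P i j"
proof -
  have "P p q" if "i \<le> p" "p < q" "q \<le> j" for p q
    using that
  proof (induction "card {p..q}" arbitrary: p q rule: less_induct)
    case less
    show ?case
    proof (cases "(p, q) \<in> simple_roots")
      case False
      then obtain k where k: "p < k" "k < q" using less.prems by (auto simp: simple_roots_def)
      have "card {p..k} < card {p..q}" "card {k..q} < card {p..q}"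
        using k by (intro psubset_card_mono; force)+
      then have "P p k" "P k q" using less k by auto
      then show ?thesis using assms(3) less.prems k by blast
    qed (use less.prems assms(2) in blast)
  qed
  then show ?thesis using assms(1) by blast
qed

text \<open>For convexity, the gap lemma places all simple roots between \<open>i\<close> and
  \<open>k\<close> in \<Gamma>; those up to \<open>j\<close> recompose the root from
  \<open>i\<close> to \<open>j\<close>.\<close>

lemma same_block_convex_equivalence:
  fixes \<Gamma> :: "('n::{finite,linorder} \<times> 'n) set"
  assumes \<Gamma>: "\<Gamma> \<subseteq> simple_roots"
  shows "convex_equivalence (same_block \<Gamma>)"
proof
  fix i j k :: 'n
  show trans: "same_block \<Gamma> i j \<Longrightarrow> same_block \<Gamma> j k \<Longrightarrow> same_block \<Gamma> i k" for i j k
    unfolding same_block_def using root_subsystem_trans by blast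
  show "same_block \<Gamma> i j" if "i \<le> j" "j \<le> k" "same_block \<Gamma> i k"
  proof (cases "i = j \<or> j = k")
    case False
    then have "i < j" "(i, k) \<in> root_subsystem \<Gamma>" using that by (auto simp: same_block_def)
    from \<open>i < j\<close> show ?thesis
    proof (rule interval_induct)
      fix p q assume "(p, q) \<in> simple_roots" "i \<le> p" "q \<le> j"
      then have "(p, q) \<in> \<Gamma>"
        using root_subsystem_gap[OF \<Gamma> \<open>(i, k) \<in> root_subsystem \<Gamma>\<close>] \<open>j \<le> k\<close> by auto
      then show "same_block \<Gamma> p q" using simple_in_root_subsystem[OF \<Gamma>] by (simp add: same_block_def)
    qed (rule trans)
  qed (use that in \<open>auto simp: same_block_def\<close>)
qed (auto simp: same_block_def root_subsystem_sym)

section \<open>The associative algebra generated by a root subsystem\<close>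

lemma same_block_supp: "same_block \<Gamma> i j \<Longrightarrow> i \<noteq> j \<Longrightarrow> i \<in> supp \<Gamma>"
  by (auto simp: same_block_def supp_def)

lemma root_subsystem_blocks: "root_subsystem \<Gamma> \<subseteq> blocks \<Gamma>"
  by (auto simp: blocks_def same_block_def supp_def)

lemma blocks_diag: "(i, i) \<in> blocks \<Gamma> \<longleftrightarrow> i \<in> supp \<Gamma>"
  by (auto simp: blocks_def same_block_def)

lemma blocks_trans: "(i, j) \<in> blocks \<Gamma> \<Longrightarrow> (j, k) \<in> blocks \<Gamma> \<Longrightarrow> (i, k) \<in> blocks \<Gamma>"
  unfolding blocks_def same_block_def using root_subsystem_trans by blast

lemma blocks_sym: "(i, j) \<in> blocks \<Gamma> \<Longrightarrow> (j, i) \<in> blocks \<Gamma>"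
  unfolding blocks_def same_block_def supp_def using root_subsystem_sym by blast

lemma blocks_supp: "(i, j) \<in> blocks \<Gamma> \<Longrightarrow> i \<in> supp \<Gamma> \<and> j \<in> supp \<Gamma>"
  using blocks_sym by (auto simp: blocks_def)

text \<open>Off-diagonal block units are root vectors; the diagonal units, which are not traceless,
  arise as products of a root vector with its opposite.\<close>

lemma A_sub_eq: "A_sub \<Gamma> = supported_on (blocks \<Gamma>)"
proof
  have assoc: "assoc_subalgebra (supported_on (blocks \<Gamma>))"
    unfolding assoc_subalgebra_def
    by (intro conjI ballI subspace_supported_on)
      (erule (1) supported_on_mult, erule (1) blocks_trans)
  then have "lie_subalgebra (supported_on (blocks \<Gamma>))"
    unfolding assoc_subalgebra_def lie_subalgebra_def lie_bracket_def
    by (simp add: mat_vs.subspace_diff)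
  then have "g_sub \<Gamma> \<subseteq> supported_on (blocks \<Gamma>)"
    unfolding g_sub_def
    by (intro hull_minimal image_subsetI)
      (simp_all add: e_vec_def subsetD[OF root_subsystem_blocks])
  then show "A_sub \<Gamma> \<subseteq> supported_on (blocks \<Gamma>)"
    unfolding A_sub_def using assoc by (rule hull_minimal)
  have "supported_on (blocks \<Gamma>) \<subseteq> T" if T: "assoc_subalgebra T" "g_sub \<Gamma> \<subseteq> T" for T
  proof (rule subspace_contains_supported_on)
    show "mat_vs.subspace T" using T by (simp add: assoc_subalgebra_def)
    have rs: "matrix_unit i j \<in> T" if "(i, j) \<in> root_subsystem \<Gamma>" for i j
      using that T(2) hull_subset[of "e_vec ` root_subsystem \<Gamma>" lie_subalgebra]
      by (force simp: g_sub_def e_vec_def)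
    fix i j assume ij: "(i, j) \<in> blocks \<Gamma>"
    show "matrix_unit i j \<in> T"
    proof (cases "i = j")
      case True
      then obtain k where k: "(i, k) \<in> root_subsystem \<Gamma>"
        using ij by (auto simp: blocks_def supp_def)
      then have "matrix_unit i k ** matrix_unit k i \<in> T"
        using rs root_subsystem_sym T(1) unfolding assoc_subalgebra_def by blast
      then show ?thesis by (simp add: matrix_unit_mult True)
    next
      case False
      then show ?thesis using ij rs by (auto simp: blocks_def same_block_def)
    qed
  qed
  then show "supported_on (blocks \<Gamma>) \<subseteq> A_sub \<Gamma>"
    unfolding A_sub_def hull_def by blast
qed

lemma hat_sub_iff: "matrix_unit i i \<in> hat_sub \<Gamma> \<longleftrightarrow> i \<in> supp \<Gamma>"
  by (simp add: hat_sub_def hat_Gamma_def A_sub_eq blocks_diag)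


section \<open>The extension as an index shift\<close>

text \<open>Expresses an entry through multiplication alone, so that algebra homomorphisms can be
  traced entry by entry.\<close>

lemma matrix_unit_sandwich:
  "matrix_unit i i ** A ** matrix_unit j j = mscale (A $ i $ j) (matrix_unit i j)"
proof -
  have 1: "(matrix_unit i i ** A) $ k $ l = (if k = i then A $ i $ l else 0)" for k l
  proof -
    have "(\<Sum>m\<in>UNIV. (matrix_unit i i :: 'a cmat) $ k $ m * A $ m $ l)
        = (\<Sum>m\<in>UNIV. if m = i then (if k = i then A $ i $ l else 0) else 0)"
      by (intro sum.cong) auto
    then show ?thesis by (simp add: matrix_mult_nth)
  qed
  have "(B ** matrix_unit j j) $ k $ l = (if l = j then B $ k $ j else 0)" for B :: "'a cmat" and k l
  proof -
    have "(\<Sum>m\<in>UNIV. B $ k $ m * (matrix_unit j j :: 'a cmat) $ m $ l)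
        = (\<Sum>m\<in>UNIV. if m = j then (if l = j then B $ k $ j else 0) else 0)"
      by (intro sum.cong) auto
    then show ?thesis by (simp add: matrix_mult_nth)
  qed
  with 1 show ?thesis by (simp add: vec_eq_iff)
qed

locale extended_BD_triple =
  fixes \<Gamma>1 \<Gamma>2 :: "('n::{finite,linorder} \<times> 'n) set"
    and \<tau> :: "'n \<times> 'n \<Rightarrow> 'n \<times> 'n"
    and \<tau>h :: "'n cmat \<Rightarrow> 'n cmat"
  assumes BD: "BD_triple \<Gamma>1 \<Gamma>2 \<tau>"
    and ext: "assoc_extension \<Gamma>1 \<Gamma>2 \<tau> \<tau>h"
    and unstable: "no_stable_points \<Gamma>1 \<tau>h"
begin

abbreviation A1 where "A1 \<equiv> supported_on (blocks \<Gamma>1)"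
abbreviation A2 where "A2 \<equiv> supported_on (blocks \<Gamma>2)"

lemma simple: "\<Gamma>1 \<subseteq> simple_roots" "\<Gamma>2 \<subseteq> simple_roots"
  using BD by (simp_all add: BD_triple_def)

lemma \<tau>h_iso: "assoc_iso A1 A2 \<tau>h"
  using ext by (simp add: assoc_extension_def A_sub_eq)

lemma \<tau>h_mult: "x \<in> A1 \<Longrightarrow> y \<in> A1 \<Longrightarrow> \<tau>h (x ** y) = \<tau>h x ** \<tau>h y"
  and \<tau>h_scale: "x \<in> A1 \<Longrightarrow> \<tau>h (mscale r x) = mscale r (\<tau>h x)"
  and \<tau>h_bij: "bij_betw \<tau>h A1 A2"
  using \<tau>h_iso by (simp_all add: assoc_iso_def linear_iso_on_def)

lemma \<tau>h_in: "x \<in> A1 \<Longrightarrow> \<tau>h x \<in> A2"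
  using \<tau>h_bij by (auto simp: bij_betw_def)

lemma \<tau>h_zero: "\<tau>h 0 = 0"
proof -
  have "\<tau>h (mscale 0 0) = mscale 0 (\<tau>h 0)" by (intro \<tau>h_scale) simp
  then show ?thesis by simp
qed

lemma \<tau>h_inj: "x \<in> A1 \<Longrightarrow> y \<in> A1 \<Longrightarrow> \<tau>h x = \<tau>h y \<longleftrightarrow> x = y"
  using \<tau>h_bij by (auto simp: bij_betw_def inj_on_def)

lemma \<tau>h_eq_0: "x \<in> A1 \<Longrightarrow> \<tau>h x = 0 \<longleftrightarrow> x = 0"
  using \<tau>h_inj[of x 0] \<tau>h_zero by simp

lemma \<tau>h_simple:
  assumes "(i, j) \<in> \<Gamma>1"
  shows "\<exists>k l. k < l \<and> \<tau>h (matrix_unit i j) = matrix_unit k l \<and> \<tau>h (matrix_unit j i) = matrix_unit l k"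
proof -
  obtain k l where kl: "\<tau> (i, j) = (k, l)" by fastforce
  have "\<tau> (i, j) \<in> simple_roots" using BD assms by (auto simp: BD_triple_def bij_betw_def)
  then have "k < l" by (simp add: kl simple_roots_def)
  have rs: "(i, j) \<in> root_subsystem \<Gamma>1" using simple_in_root_subsystem simple assms by blast
  then have "e_vec (i, j) \<in> g_sub \<Gamma>1" "e_vec (j, i) \<in> g_sub \<Gamma>1"
    unfolding g_sub_def using root_subsystem_sym by (blast intro: hull_inc)+
  then have "\<tau>h (e_vec (i, j)) = e_vec (\<tau> (i, j))" "\<tau>h (f_vec (i, j)) = f_vec (\<tau> (i, j))"
    using ext assms by (auto simp: assoc_extension_def lie_extension_def e_vec_def f_vec_def)
  with \<open>k < l\<close> show ?thesis by (auto simp: kl e_vec_def f_vec_def)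
qed

text \<open>The unit of a positive root is a product of units of simple roots, on which
  \<open>\<tau>h\<close> is prescribed. The transposed unit is carried along to obtain the diagonal
  units later.\<close>

lemma \<tau>h_positive:
  assumes "(i, j) \<in> root_subsystem \<Gamma>1" "i < j"
  shows "\<exists>k l. k < l \<and> \<tau>h (matrix_unit i j) = matrix_unit k l \<and> \<tau>h (matrix_unit j i) = matrix_unit l k"
proof -
  interpret convex_equivalence "same_block \<Gamma>1" by (rule same_block_convex_equivalence[OF simple(1)])
  have E: "same_block \<Gamma>1 i j" using assms by (simp add: same_block_def)
  let ?P = "\<lambda>i j. (\<exists>k l. k < l \<and> \<tau>h (matrix_unit i j) = matrix_unit k l \<and>
      \<tau>h (matrix_unit j i) = matrix_unit l k)"
  from \<open>i < j\<close> show "?P i j"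
  proof (rule interval_induct)
    fix p q assume "(p, q) \<in> simple_roots" "i \<le> p" "q \<le> j"
    then show "?P p q" using root_subsystem_gap[OF simple(1) assms(1)] \<tau>h_simple by blast
  next
    fix p q r assume *: "i \<le> p" "p < q" "q < r" "r \<le> j" "?P p q" "?P q r"
    obtain a b c d where ab: "a < b" "\<tau>h (matrix_unit p q) = matrix_unit a b" "\<tau>h (matrix_unit q p) = matrix_unit b a"
      and cd: "c < d" "\<tau>h (matrix_unit q r) = matrix_unit c d" "\<tau>h (matrix_unit r q) = matrix_unit d c"
      using *(5,6) by blast
    have "same_block \<Gamma>1 i m" if "i \<le> m" "m \<le> j" for m
      using convex[OF that E] .
    then have "same_block \<Gamma>1 i p" "same_block \<Gamma>1 i q" "same_block \<Gamma>1 i r"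
      using *(1-4) by auto
    then have "same_block \<Gamma>1 p q" "same_block \<Gamma>1 q r"
      by (blast intro: trans[OF sym])+
    then have "(p, q) \<in> blocks \<Gamma>1" "(q, r) \<in> blocks \<Gamma>1"
      using *(2,3) same_block_supp[of \<Gamma>1 p q] same_block_supp[of \<Gamma>1 q r]
      by (auto simp: blocks_def)
    then have u: "matrix_unit p q \<in> A1" "matrix_unit q r \<in> A1" "matrix_unit q p \<in> A1"
        "matrix_unit r q \<in> A1" "matrix_unit p r \<in> A1"
      using blocks_sym blocks_trans by auto
    have pr: "\<tau>h (matrix_unit p r) = matrix_unit a b ** matrix_unit c d"
      using \<tau>h_mult[OF u(1,2)] ab cd by (simp add: matrix_unit_mult)
    \<comment> \<open>By injectivity the image is nonzero, so the inner indices of the product must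
      agree.\<close>
    then have "b = c" using \<tau>h_eq_0[OF u(5)] by (auto simp: matrix_unit_mult split: if_splits)
    moreover have "\<tau>h (matrix_unit r p) = matrix_unit d c ** matrix_unit b a"
      using \<tau>h_mult[OF u(4,3)] ab cd by (simp add: matrix_unit_mult)
    ultimately show "?P p r" using pr ab cd by (auto simp: matrix_unit_mult intro: less_trans)
  qed
qed

text \<open>The index map underlying the extension. Outside \<open>supp \<Gamma>1\<close> the
  diagonal unit is not in the domain of the isomorphism and the value is arbitrary.\<close>

definition t :: "'n \<Rightarrow> 'n" where
  "t i = (SOME k. \<tau>h (matrix_unit i i) = matrix_unit k k)"

text \<open>An index in the support has a partner \<open>j\<close>, and the diagonal unit is the
  product of the two opposite units, whose images are again opposite.\<close>

lemma \<tau>h_diag: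
  assumes "i \<in> supp \<Gamma>1" shows "\<tau>h (matrix_unit i i) = matrix_unit (t i) (t i)"
proof -
  obtain j where ij: "(i, j) \<in> root_subsystem \<Gamma>1" using assms by (auto simp: supp_def)
  then have ji: "(j, i) \<in> root_subsystem \<Gamma>1" by (rule root_subsystem_sym)
  have "\<exists>k l. \<tau>h (matrix_unit i j) = matrix_unit k l \<and> \<tau>h (matrix_unit j i) = matrix_unit l k"
  proof (cases i j rule: linorder_cases)
    case less
    then show ?thesis using \<tau>h_positive[OF ij] by blast
  next
    case greater
    then show ?thesis using \<tau>h_positive[OF ji] by blast
  qed (use root_subsystem_irrefl[OF ij] in simp)
  then obtain k l where "\<tau>h (matrix_unit i j) = matrix_unit k l" "\<tau>h (matrix_unit j i) = matrix_unit l k"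
    by blast
  moreover have "matrix_unit i j \<in> A1" "matrix_unit j i \<in> A1"
    using ij ji root_subsystem_blocks by auto
  ultimately have "\<tau>h (matrix_unit i i) = matrix_unit k k"
    using \<tau>h_mult[of "matrix_unit i j" "matrix_unit j i"] by (simp add: matrix_unit_mult)
  then show ?thesis unfolding t_def by (rule someI)
qed

lemma \<tau>h_unit:
  assumes ij: "(i, j) \<in> blocks \<Gamma>1"
  shows "\<tau>h (matrix_unit i j) = matrix_unit (t i) (t j)" "i < j \<Longrightarrow> t i < t j"
proof -
  have "\<exists>k l. \<tau>h (matrix_unit i j) = matrix_unit k l \<and> (i < j \<longrightarrow> k < l)"
  proof (cases "i = j")
    case True
    then show ?thesis using \<tau>h_diag[of i] blocks_supp[OF ij] by auto
  next
    case False
    then have rs: "(i, j) \<in> root_subsystem \<Gamma>1" using ij by (auto simp: blocks_def same_block_def)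
    show ?thesis
    proof (cases i j rule: linorder_cases)
      case less
      then show ?thesis using \<tau>h_positive[OF rs] by blast
    next
      case greater
      then have "\<not> i < j" by simp
      then show ?thesis using \<tau>h_positive[OF root_subsystem_sym[OF rs] greater] by blast
    qed (use False in simp)
  qed
  then obtain k l where kl: "\<tau>h (matrix_unit i j) = matrix_unit k l" and kl': "i < j \<longrightarrow> k < l"
    by blast
  have s: "i \<in> supp \<Gamma>1" "j \<in> supp \<Gamma>1" using ij blocks_supp by auto
  have A: "matrix_unit i j \<in> A1" "matrix_unit i i \<in> A1" "matrix_unit j j \<in> A1"
    using ij s by (simp_all add: blocks_diag)
  \<comment> \<open>Multiplying by the diagonal units on either side identifies the two indices of
    the image; otherwise the product would be zero.\<close>
  have "matrix_unit (t i) (t i) ** matrix_unit k l = matrix_unit k l"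
    using \<tau>h_mult[OF A(2,1)] by (simp add: kl \<tau>h_diag[OF s(1)] matrix_unit_mult[of i i])
  then have k: "t i = k" by (rule contrapos_pp) (simp add: matrix_unit_mult)
  have "matrix_unit k l ** matrix_unit (t j) (t j) = matrix_unit k l"
    using \<tau>h_mult[OF A(1,3)] by (simp add: kl \<tau>h_diag[OF s(2)] matrix_unit_mult[of i j])
  then have l: "l = t j" by (rule contrapos_pp) (simp add: matrix_unit_mult)
  show "\<tau>h (matrix_unit i j) = matrix_unit (t i) (t j)" "i < j \<Longrightarrow> t i < t j"
    using kl kl' by (simp_all add: k l)
qed

lemma \<tau>h_sandwich:
  assumes a: "a \<in> A1" and i: "i \<in> supp \<Gamma>1" and j: "j \<in> supp \<Gamma>1"
  shows "mscale (\<tau>h a $ t i $ t j) (matrix_unit (t i) (t j)) = \<tau>h (mscale (a $ i $ j) (matrix_unit i j))"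
proof -
  have u: "matrix_unit i i \<in> A1" "matrix_unit j j \<in> A1" using i j by (simp_all add: blocks_diag)
  have "matrix_unit i i ** a \<in> A1" using u(1) a by (rule supported_on_mult) (rule blocks_trans)
  then have "\<tau>h (matrix_unit i i ** a ** matrix_unit j j)
      = matrix_unit (t i) (t i) ** \<tau>h a ** matrix_unit (t j) (t j)"
    using \<tau>h_mult[OF _ u(2)] \<tau>h_mult[OF u(1) a] by (simp only: \<tau>h_diag i j)
  then show ?thesis by (simp add: matrix_unit_sandwich)
qed

lemma \<tau>h_nth:
  assumes a: "a \<in> A1" and ij: "(i, j) \<in> blocks \<Gamma>1"
  shows "\<tau>h a $ t i $ t j = a $ i $ j"
proof -
  have u: "matrix_unit i j \<in> A1" using ij by simp
  have "mscale (\<tau>h a $ t i $ t j) (matrix_unit (t i) (t j)) = \<tau>h (mscale (a $ i $ j) (matrix_unit i j))"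
    using a blocks_supp[OF ij] by (intro \<tau>h_sandwich) auto
  also have "\<dots> = mscale (a $ i $ j) (matrix_unit (t i) (t j))"
    by (simp only: \<tau>h_scale[OF u] \<tau>h_unit(1)[OF ij])
  finally show ?thesis by (simp add: mat_vs.scale_cancel_right)
qed

section \<open>The index map as a bijection between blocks\<close>

lemma t_blocks: "(i, j) \<in> blocks \<Gamma>1 \<Longrightarrow> (t i, t j) \<in> blocks \<Gamma>2"
  using \<tau>h_in[of "matrix_unit i j"] \<tau>h_unit(1) by simp

text \<open>Distinct blocks are not merged: a preimage of the unit at \<open>(t i, t j)\<close>
  would have entry zero at \<open>(i, j)\<close>, contradicting
  \<open>\<tau>h_sandwich\<close>.\<close>

lemma t_blocks_conv:
  assumes "i \<in> supp \<Gamma>1" "j \<in> supp \<Gamma>1" "(t i, t j) \<in> blocks \<Gamma>2"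
  shows "(i, j) \<in> blocks \<Gamma>1"
proof (rule ccontr)
  assume n: "(i, j) \<notin> blocks \<Gamma>1"
  have "matrix_unit (t i) (t j) \<in> \<tau>h ` A1" using assms(3) \<tau>h_bij by (simp add: bij_betw_def)
  then obtain a where a: "a \<in> A1" "\<tau>h a = matrix_unit (t i) (t j)" by auto
  then have "a $ i $ j = 0" using supported_onD n by blast
  then have "mscale (\<tau>h a $ t i $ t j) (matrix_unit (t i) (t j)) = 0"
    using \<tau>h_sandwich[OF a(1) assms(1,2)] \<tau>h_zero by simp
  then show False by (simp add: a)
qed

lemma t_bij: "bij_betw t (supp \<Gamma>1) (supp \<Gamma>2)"
  unfolding bij_betw_def
proof (intro conjI inj_onI equalityI subsetI)
  fix i j assume ij: "i \<in> supp \<Gamma>1" "j \<in> supp \<Gamma>1" "t i = t j"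
  then have "\<tau>h (matrix_unit i i) = \<tau>h (matrix_unit j j)" by (simp add: \<tau>h_diag)
  moreover have "matrix_unit i i \<in> A1" "matrix_unit j j \<in> A1" using ij by (simp_all add: blocks_diag)
  ultimately show "i = j" using \<tau>h_inj by simp
next
  fix k assume "k \<in> t ` supp \<Gamma>1"
  then show "k \<in> supp \<Gamma>2" using t_blocks by (auto simp flip: blocks_diag)
next
  fix k assume k: "k \<in> supp \<Gamma>2"
  then have "matrix_unit k k \<in> \<tau>h ` A1"
    using \<tau>h_bij by (simp add: bij_betw_def blocks_diag)
  then obtain a where a: "a \<in> A1" "\<tau>h a = matrix_unit k k" by auto
  show "k \<in> t ` supp \<Gamma>1"
  proof (rule ccontr)
    assume n: "k \<notin> t ` supp \<Gamma>1"
    \<comment> \<open>Entries of \<open>a\<close> reappear in the image in rows of the form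
      \<open>t i\<close>, but the only nonzero row of the image is \<open>k\<close>.\<close>
    have "a $ i $ j = 0" for i j
    proof (cases "(i, j) \<in> blocks \<Gamma>1")
      case True
      then have "t i \<noteq> k" using n blocks_supp by blast
      then show ?thesis using \<tau>h_nth[OF a(1) True] by (auto simp: a(2) split: if_splits)
    qed (use supported_onD[OF a(1)] in blast)
    then have "a = 0" by (simp add: vec_eq_iff)
    then show False using a(2) \<tau>h_zero by (metis matrix_unit_nonzero)
  qed
qed

text \<open>Induction on the time \<open>m\<close> at which the orbit of a diagonal unit leaves
  \<open>hat_sub \<Gamma>1\<close>; one application of \<open>\<tau>h\<close> is one application of
  \<open>t\<close>.\<close>

lemma t_wf: "wf {(t i, i) | i. i \<in> supp \<Gamma>1}"
  unfolding wf_def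
proof (intro allI impI)
  fix P x assume "\<forall>x. (\<forall>y. (y, x) \<in> {(t i, i) | i. i \<in> supp \<Gamma>1} \<longrightarrow> P y) \<longrightarrow> P x"
  then have step: "(i \<in> supp \<Gamma>1 \<Longrightarrow> P (t i)) \<Longrightarrow> P i" for i by blast
  have P: "P i" if "\<forall>k<m. (\<tau>h ^^ k) (matrix_unit i i) \<in> hat_sub \<Gamma>1"
    "(\<tau>h ^^ m) (matrix_unit i i) \<notin> hat_sub \<Gamma>1" for m i
    using that
  proof (induction m arbitrary: i)
    case 0
    then show ?case using step hat_sub_iff by auto
  next
    case (Suc m)
    have "matrix_unit i i \<in> hat_sub \<Gamma>1" using Suc.prems(1) by (metis funpow_0 zero_less_Suc)
    then have i: "i \<in> supp \<Gamma>1" by (simp add: hat_sub_iff)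
    then have shift: "(\<tau>h ^^ Suc k) (matrix_unit i i) = (\<tau>h ^^ k) (matrix_unit (t i) (t i))" for k
      by (simp add: funpow_Suc_right \<tau>h_diag del: funpow.simps)
    have "\<forall>k<m. (\<tau>h ^^ k) (matrix_unit (t i) (t i)) \<in> hat_sub \<Gamma>1"
      using Suc.prems(1) shift by (metis Suc_less_eq)
    moreover have "(\<tau>h ^^ m) (matrix_unit (t i) (t i)) \<notin> hat_sub \<Gamma>1"
      using Suc.prems(2) shift by metis
    ultimately show ?case using Suc.IH step by blast
  qed
  show "P x"
  proof (cases "x \<in> supp \<Gamma>1")
    case True
    then have "matrix_unit x x \<in> hat_sub \<Gamma>1" by (simp add: hat_sub_iff)
    then show ?thesis using unstable P unfolding no_stable_points_def by blast
  qed (use step in blast)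
qed

sublocale block_shift "same_block \<Gamma>1" "same_block \<Gamma>2" "supp \<Gamma>1" "supp \<Gamma>2" t
proof (intro block_shift.intro block_shift_axioms.intro same_block_convex_equivalence simple)
  show "same_block \<Gamma>2 (t i) (t j) \<longleftrightarrow> same_block \<Gamma>1 i j" if "i \<in> supp \<Gamma>1" "j \<in> supp \<Gamma>1" for i j
  proof -
    have "t i \<in> supp \<Gamma>2" using that t_bij by (auto simp: bij_betw_def)
    then show ?thesis using t_blocks[of i j] t_blocks_conv[of i j] that by (auto simp: blocks_def)
  qed
  show "t i < t j" if "i \<in> supp \<Gamma>1" "same_block \<Gamma>1 i j" "i < j" for i j
    using that by (intro \<tau>h_unit(2)) (simp_all add: blocks_def)
qed (erule (1) same_block_supp | rule t_bij t_wf)+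

end

section \<open>Identification with the coordinate description\<close>

context block_shift
begin

lemma Q_diag1: "w \<in> supported_on (Id_on (- I1)) \<Longrightarrow> (0, w, 0) \<in> Q"
  using blk1.refl E1_outside by (fastforce simp: Q_def supported_on_def blk1.up_def)

lemma Np_diag2:
  assumes "y \<in> supported_on (Id_on (- I2))" shows "(y, 0, y) \<in> Np"
proof -
  have "y $ t i $ t j = 0" if "i \<in> I1" for i j
    using supported_onD[OF assms, of "t i" "t j"] t_in[OF that] by auto
  moreover have "y \<in> supported_on (blk2.up\<inverse>)"
    using assms blk2.refl by (fastforce simp: supported_on_def blk2.up_def)
  ultimately show ?thesis using assms by (simp add: Np_def Q_def)
qed

lemma Np_minus_diag:
  assumes "(y, b, c) \<in> Np" shows "(0, b, c - y) \<in> Np"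
proof -
  have y: "y \<in> supported_on (Id_on (- I2))" using assms by (auto simp: Np_def Q_def)
  show ?thesis
    using Np_subspace(2)[OF assms Np_subspace(3)[OF Np_diag2[OF y], of "-1"]]
    by (simp add: mat_vs.scale_minus_left)
qed

text \<open>Moving the diagonal of \<open>b\<close> outside \<open>I1\<close> into \<open>w\<close>
  splits off the contribution of \<open>alg_d1\<close>.\<close>

lemma Q_split:
  assumes "(y, b, c) \<in> Q"
  obtains w where "w \<in> supported_on (Id_on (- I1))" "(y, b - w, c) \<in> Np"
proof -
  define w :: "'n cmat" where "w = (\<chi> i j. if i = j \<and> i \<notin> I1 then b $ i $ i else 0)"
  have w: "w \<in> supported_on (Id_on (- I1))" by (auto simp: supported_on_def w_def)
  have "(y, b - w, c) \<in> Q"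
    using Q_subspace(2)[OF assms Q_subspace(3)[OF Q_diag1[OF w], of "-1"]]
    by (simp add: mat_vs.scale_minus_left)
  then have "(y, b - w, c) \<in> Np" by (simp add: Np_def w_def)
  with w that show thesis by blast
qed

lemma Q_unique:
  assumes "(y, b, c) \<in> Q" "(y', b', c) \<in> Q" shows "y = y'"
proof -
  have "y $ i $ j = y' $ i $ j" for i j
  proof (cases "i = j \<and> i \<notin> I2")
    case True
    then show ?thesis using in_QD(4)[OF assms(1)] in_QD(4)[OF assms(2)] by metis
  next
    case False
    then show ?thesis using in_QD(1)[OF assms(1), of i j] in_QD(1)[OF assms(2), of i j] by auto
  qed
  then show ?thesis by (simp add: vec_eq_iff)
qed

end

context extended_BD_triple
begin

lemma span_e_vec: "mat_vs.span (e_vec ` S) = supported_on S"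
  and span_f_vec: "mat_vs.span (f_vec ` S) = supported_on (S\<inverse>)"
proof -
  have "e_vec ` S = (\<lambda>(i, j). matrix_unit i j) ` S"
    by (intro image_cong) (auto simp: e_vec_def)
  then show "mat_vs.span (e_vec ` S) = supported_on S" by (simp add: span_matrix_units)
  have "f_vec ` S = (\<lambda>(i, j). matrix_unit i j) ` (S\<inverse>)"
  proof -
    have "S\<inverse> = prod.swap ` S" by force
    then show ?thesis by (auto simp: image_image f_vec_def case_prod_unfold)
  qed
  then show "mat_vs.span (f_vec ` S) = supported_on (S\<inverse>)" by (simp add: span_matrix_units)
qed

lemma not_in_blocks_cases:
  assumes "(i, j) \<notin> blocks \<Gamma>" and "i < j \<or> same_block \<Gamma> i j"
  shows "i = j \<and> i \<notin> supp \<Gamma> \<or> (i, j) \<in> positive_roots - root_subsystem \<Gamma>"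
proof (cases "i = j")
  case True
  then show ?thesis using assms(1) by (simp add: blocks_diag)
next
  case False
  have "\<not> same_block \<Gamma> i j" using assms(1) same_block_supp[OF _ False] by (auto simp: blocks_def)
  then show ?thesis using assms(2) by (simp add: same_block_def positive_roots_def)
qed

text \<open>\<BB> is the part of \<open>Np\<close> with zero first component: the block part of
  \<open>b\<close> is \<open>a\<close>, the block part of \<open>c\<close> is its shift, and
  \<open>u\<close>, \<open>v\<close> are the strictly triangular remainders off the blocks.\<close>

lemma alg_B_eq: "(b, c) \<in> alg_B \<Gamma>1 \<Gamma>2 \<tau>h \<longleftrightarrow> (0, b, c) \<in> Np"
proof
  assume "(b, c) \<in> alg_B \<Gamma>1 \<Gamma>2 \<tau>h"
  then obtain a u v where b: "b = a + u" and c: "c = \<tau>h a + v" and a: "a \<in> A1"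
    and u: "u \<in> supported_on (positive_roots - root_subsystem \<Gamma>1)"
    and v: "v \<in> supported_on ((positive_roots - root_subsystem \<Gamma>2)\<inverse>)"
    by (auto simp: alg_B_def A_sub_eq span_e_vec span_f_vec)
  have ta: "\<tau>h a \<in> A2" by (rule \<tau>h_in[OF a])
  have u0: "u $ i $ j = 0" if "\<not> i < j \<or> same_block \<Gamma>1 i j" for i j
    using supported_onD[OF u, of i j] that by (auto simp: same_block_def positive_roots_def)
  have v0: "v $ i $ j = 0" if "same_block \<Gamma>2 i j \<or> \<not> j < i" for i j
    using supported_onD[OF v, of i j] that blk2.sym[of i j]
    by (auto simp: same_block_def positive_roots_def)
  have a0: "a $ i $ j = 0" if "(i, j) \<notin> blocks \<Gamma>1" for i j using supported_onD[OF a that] .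
  have ta0: "\<tau>h a $ i $ j = 0" if "(i, j) \<notin> blocks \<Gamma>2" for i j using supported_onD[OF ta that] .
  have "b $ i $ j = 0" if "(i, j) \<notin> blk1.up" for i j
    using that u0[of i j] a0[of i j] by (simp add: b blk1.up_def blocks_def)
  then have b_supp: "b \<in> supported_on blk1.up" by (auto simp: supported_on_def)
  have "c $ i $ j = 0" if "(j, i) \<notin> blk2.up" for i j
  proof -
    have "\<not> j < i" "\<not> same_block \<Gamma>2 i j" using that blk2.sym by (auto simp: blk2.up_def)
    then show ?thesis using v0[of i j] ta0[of i j] by (simp add: c blocks_def)
  qed
  then have c_supp: "c \<in> supported_on (blk2.up\<inverse>)" by (auto simp: supported_on_def)
  have b_out: "b $ i $ i = 0" if "i \<notin> supp \<Gamma>1" for i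
    using that u0[of i i] a0[of i i] by (simp add: b blocks_diag)
  have c_out: "c $ i $ i = 0" if "i \<notin> supp \<Gamma>2" for i
    using that v0[of i i] ta0[of i i] by (simp add: c blocks_diag)
  have "c $ t i $ t j = b $ i $ j" if "i \<in> supp \<Gamma>1" "same_block \<Gamma>1 i j" for i j
  proof -
    have ij: "(i, j) \<in> blocks \<Gamma>1" using that by (simp add: blocks_def)
    then have "same_block \<Gamma>2 (t i) (t j)" using t_blocks by (auto simp: blocks_def)
    then show ?thesis using \<tau>h_nth[OF a ij] u0[of i j] v0[of "t i" "t j"] that by (simp add: b c)
  qed
  then show "(0, b, c) \<in> Np"
    using b_supp c_supp b_out c_out by (simp add: Np_def Q_def)
next
  assume "(0, b, c) \<in> Np"
  then have Q: "(0, b, c) \<in> Q" and b_out: "\<And>i. i \<notin> supp \<Gamma>1 \<Longrightarrow> b $ i $ i = 0"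
    by (auto simp: Np_def)
  define a :: "'n cmat" where "a = (\<chi> i j. if (i, j) \<in> blocks \<Gamma>1 then b $ i $ j else 0)"
  have a: "a \<in> A1" by (auto simp: a_def supported_on_def)
  have ta: "\<tau>h a \<in> A2" by (rule \<tau>h_in[OF a])
  have "(b - a) $ i $ j = 0" if "(i, j) \<notin> positive_roots - root_subsystem \<Gamma>1" for i j
  proof (cases "(i, j) \<in> blocks \<Gamma>1")
    case False
    then show ?thesis
      using in_QD(2)[OF Q, of i j] not_in_blocks_cases[OF False] b_out that
      by (auto simp: a_def blk1.up_def)
  qed (simp add: a_def)
  then have u: "b - a \<in> supported_on (positive_roots - root_subsystem \<Gamma>1)"
    unfolding supported_on_def by blast
  have "(c - \<tau>h a) $ i $ j = 0" if n: "(j, i) \<notin> positive_roots - root_subsystem \<Gamma>2" for i j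
  proof (cases "(i, j) \<in> blocks \<Gamma>2")
    case True
    then have "i \<in> supp \<Gamma>2" "j \<in> supp \<Gamma>2" using blocks_supp by blast+
    then obtain k l where kl: "k \<in> supp \<Gamma>1" "l \<in> supp \<Gamma>1" "i = t k" "j = t l"
      using t_preimage by metis
    then have "(k, l) \<in> blocks \<Gamma>1" using t_blocks_conv True by blast
    then show ?thesis
      using in_QD(5)[OF Q, of k l] \<tau>h_nth[OF a, of k l] kl by (simp add: a_def blocks_def)
  next
    case False
    then have "(j, i) \<notin> blocks \<Gamma>2" using blocks_sym by blast
    then have "c $ i $ j = 0"
      using in_QD(3)[OF Q, of j i] in_QD(4)[OF Q, of i] not_in_blocks_cases[of j i \<Gamma>2] n
      by (auto simp: blk2.up_def)
    then show ?thesis using supported_onD[OF ta False] by simp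
  qed
  then have v: "c - \<tau>h a \<in> supported_on ((positive_roots - root_subsystem \<Gamma>2)\<inverse>)"
    unfolding supported_on_def by blast
  have "b = a + (b - a)" "c = \<tau>h a + (c - \<tau>h a)" by simp_all
  with a u v show "(b, c) \<in> alg_B \<Gamma>1 \<Gamma>2 \<tau>h"
    unfolding alg_B_def A_sub_eq span_e_vec span_f_vec by blast
qed

section \<open>The diagonal complements and the projection \<open>gamma2\<close>\<close>

lemma hat_complement:
  "hat_Gamma - hat_sub \<Gamma> = (\<lambda>(i, j). matrix_unit i j) ` Id_on (- supp \<Gamma>)"
  by (auto simp: hat_Gamma_def hat_sub_iff)

lemma alg_d1_eq: "alg_d1 \<Gamma>1 = supported_on (Id_on (- supp \<Gamma>1)) \<times> {0}"
proof -
  have "(\<lambda>\<eta>. (\<eta>, 0)) ` (hat_Gamma - hat_sub \<Gamma>1)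
      = ((\<lambda>(i, j). matrix_unit i j) ` Id_on (- supp \<Gamma>1)) \<times> {0 :: 'n cmat}"
    unfolding hat_complement by auto
  then show ?thesis
    by (simp add: alg_d1_def mat2_vs.span_Times_sing2 span_matrix_units)
qed

lemma alg_d2_eq: "alg_d2 \<Gamma>2 = {0} \<times> supported_on (Id_on (- supp \<Gamma>2))"
proof -
  have "(\<lambda>\<eta>. (0, \<eta>)) ` (hat_Gamma - hat_sub \<Gamma>2)
      = {0 :: 'n cmat} \<times> ((\<lambda>(i, j). matrix_unit i j) ` Id_on (- supp \<Gamma>2))"
    unfolding hat_complement by auto
  then show ?thesis
    by (simp add: alg_d2_def mat2_vs.span_Times_sing1 span_matrix_units)
qed

text \<open>Thus \<open>Q\<close> is the sum of the three subspaces with the \<open>alg_d2\<close>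
  component recorded in the first slot, i.e. the graph of the projection to
  \<open>alg_d2\<close>.\<close>

lemma B_d1_d2_iff:
  "(\<exists>p\<in>alg_B \<Gamma>1 \<Gamma>2 \<tau>h. \<exists>q\<in>alg_d1 \<Gamma>1. (b, c) = p + q + (0, y)) \<and> (0, y) \<in> alg_d2 \<Gamma>2
    \<longleftrightarrow> (y, b, c) \<in> Q"
proof
  assume "(\<exists>p\<in>alg_B \<Gamma>1 \<Gamma>2 \<tau>h. \<exists>q\<in>alg_d1 \<Gamma>1. (b, c) = p + q + (0, y)) \<and> (0, y) \<in> alg_d2 \<Gamma>2"
  then obtain b' c' w where N: "(0, b', c') \<in> Np" and w: "w \<in> supported_on (Id_on (- supp \<Gamma>1))"
    and y: "y \<in> supported_on (Id_on (- supp \<Gamma>2))" and bc: "b = b' + w" "c = c' + y"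
    by (auto simp: alg_d1_eq alg_d2_eq alg_B_eq)
  have "(0, b', c') \<in> Q" "(y, 0, y) \<in> Q" using N Np_diag2[OF y] Np_subset_Q by blast+
  from Q_subspace(2)[OF Q_subspace(2)[OF this(1) Q_diag1[OF w]] this(2)]
  show "(y, b, c) \<in> Q" by (simp add: bc)
next
  assume Q: "(y, b, c) \<in> Q"
  then obtain w where w: "w \<in> supported_on (Id_on (- supp \<Gamma>1))" and "(y, b - w, c) \<in> Np"
    by (rule Q_split)
  then have "(b - w, c - y) \<in> alg_B \<Gamma>1 \<Gamma>2 \<tau>h" using Np_minus_diag alg_B_eq by blast
  moreover have "(w, 0) \<in> alg_d1 \<Gamma>1" using w by (simp add: alg_d1_eq)
  moreover have "(b, c) = (b - w, c - y) + (w, 0) + (0, y)" by simp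
  moreover have "(0, y) \<in> alg_d2 \<Gamma>2" using Q by (auto simp: alg_d2_eq Q_def)
  ultimately show "(\<exists>p\<in>alg_B \<Gamma>1 \<Gamma>2 \<tau>h. \<exists>q\<in>alg_d1 \<Gamma>1. (b, c) = p + q + (0, y)) \<and> (0, y) \<in> alg_d2 \<Gamma>2"
    by blast
qed

text \<open>The definite description is legitimate because \<open>Q_unique\<close> recovers the
  first slot from the diagonal of \<open>c\<close> outside the support.\<close>

lemma gamma2_eq:
  assumes "(y, b, c) \<in> Q" shows "gamma2 \<Gamma>1 \<Gamma>2 \<tau>h (b, c) = (0, y)"
  unfolding gamma2_def
proof (rule the_equality)
  show "(0, y) \<in> alg_d2 \<Gamma>2 \<and> (\<exists>p\<in>alg_B \<Gamma>1 \<Gamma>2 \<tau>h. \<exists>w\<in>alg_d1 \<Gamma>1. (b, c) = p + w + (0, y))"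
    using assms B_d1_d2_iff by blast
  fix z assume z: "z \<in> alg_d2 \<Gamma>2 \<and> (\<exists>p\<in>alg_B \<Gamma>1 \<Gamma>2 \<tau>h. \<exists>w\<in>alg_d1 \<Gamma>1. (b, c) = p + w + z)"
  then obtain y' where y': "z = (0, y')" by (auto simp: alg_d2_eq)
  then have "(y', b, c) \<in> Q" using z B_d1_d2_iff by blast
  then show "z = (0, y)" using Q_unique[OF assms] y' by simp
qed

lemma alg_d_iff: "(x, x) \<in> alg_d \<Gamma>1 \<Gamma>2 \<tau>h \<longleftrightarrow> (\<exists>y. (y, x, x) \<in> Q)"
proof
  assume "(x, x) \<in> alg_d \<Gamma>1 \<Gamma>2 \<tau>h"
  then obtain p q r where "p \<in> alg_B \<Gamma>1 \<Gamma>2 \<tau>h" "q \<in> alg_d1 \<Gamma>1" "r \<in> alg_d2 \<Gamma>2" "(x, x) = p + q + r"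
    unfolding alg_d_def by (auto elim!: set_plus_elim)
  moreover from this(3) obtain y where "r = (0, y)" by (auto simp: alg_d2_eq)
  ultimately show "\<exists>y. (y, x, x) \<in> Q" using B_d1_d2_iff by blast
next
  assume "\<exists>y. (y, x, x) \<in> Q"
  then obtain y p q where "p \<in> alg_B \<Gamma>1 \<Gamma>2 \<tau>h" "q \<in> alg_d1 \<Gamma>1" "(0, y) \<in> alg_d2 \<Gamma>2"
    and x: "(x, x) = p + q + (0, y)"
    using B_d1_d2_iff by blast
  then have "p + q + (0, y) \<in> alg_B \<Gamma>1 \<Gamma>2 \<tau>h + alg_d1 \<Gamma>1 + alg_d2 \<Gamma>2"
    by (intro set_plus_intro)
  then show "(x, x) \<in> alg_d \<Gamma>1 \<Gamma>2 \<tau>h" by (simp add: alg_d_def x[symmetric])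
qed

lemma alg_D_eq: "alg_D \<Gamma>1 \<Gamma>2 \<tau>h = D"
  unfolding alg_D_def D_def alg_d_iff by (auto simp: gamma2_eq)

text \<open>The projection is onto because \<open>D_extend\<close> completes every diagonal
  \<open>y\<close> to an element of \<open>D\<close>.\<close>

lemma gamma2_image: "snd ` gamma2 \<Gamma>1 \<Gamma>2 \<tau>h ` alg_d \<Gamma>1 \<Gamma>2 \<tau>h = supported_on (Id_on (- supp \<Gamma>2))"
proof
  show "snd ` gamma2 \<Gamma>1 \<Gamma>2 \<tau>h ` alg_d \<Gamma>1 \<Gamma>2 \<tau>h \<subseteq> supported_on (Id_on (- supp \<Gamma>2))"
  proof (unfold image_image, intro image_subsetI)
    fix z assume z: "z \<in> alg_d \<Gamma>1 \<Gamma>2 \<tau>h"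
    then obtain x where x: "z = (x, x)" by (auto simp: alg_d_def)
    then obtain y where "(y, x, x) \<in> Q" using z alg_d_iff by blast
    then show "snd (gamma2 \<Gamma>1 \<Gamma>2 \<tau>h z) \<in> supported_on (Id_on (- supp \<Gamma>2))"
      by (simp add: x gamma2_eq) (simp add: Q_def)
  qed
  show "supported_on (Id_on (- supp \<Gamma>2)) \<subseteq> snd ` gamma2 \<Gamma>1 \<Gamma>2 \<tau>h ` alg_d \<Gamma>1 \<Gamma>2 \<tau>h"
  proof
    fix y :: "'n cmat" assume "y \<in> supported_on (Id_on (- supp \<Gamma>2))"
    then obtain x where x: "(y, x, x) \<in> Q" using D_extend by (auto simp: D_def)
    then have "(x, x) \<in> alg_d \<Gamma>1 \<Gamma>2 \<tau>h" using alg_d_iff by blast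
    then have "snd (gamma2 \<Gamma>1 \<Gamma>2 \<tau>h (x, x)) \<in> snd ` gamma2 \<Gamma>1 \<Gamma>2 \<tau>h ` alg_d \<Gamma>1 \<Gamma>2 \<tau>h"
      by (intro imageI)
    then show "y \<in> snd ` gamma2 \<Gamma>1 \<Gamma>2 \<tau>h ` alg_d \<Gamma>1 \<Gamma>2 \<tau>h" by (simp add: gamma2_eq[OF x])
  qed
qed

text \<open>Subtracting \<open>(y, 0, y)\<close> leaves an element of \<open>Np\<close> with zero
  first slot, which lies in \<open>alg_B\<close> up to the leading zero.\<close>

lemma alg_Nplus_eq: "alg_Nplus \<Gamma>1 \<Gamma>2 \<tau>h = Np"
  unfolding alg_Nplus_def gamma2_image alg_B_eq
proof (intro equalityI subsetI)
  fix x assume "x \<in> {(y, 0, y) | y. y \<in> supported_on (Id_on (- supp \<Gamma>2))} +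
      {(0, b1, b2) | b1 b2. (0, b1, b2) \<in> Np}"
  then obtain y b c where x: "x = (y, b, y + c)" and y: "y \<in> supported_on (Id_on (- supp \<Gamma>2))"
    and N: "(0, b, c) \<in> Np" by (auto elim!: set_plus_elim)
  show "x \<in> Np" using Np_subspace(2)[OF Np_diag2[OF y] N] by (simp add: x)
next
  fix x assume x: "x \<in> Np"
  obtain y b c where xe: "x = (y, b, c)" by (cases x) auto
  have y: "y \<in> supported_on (Id_on (- supp \<Gamma>2))" using x by (auto simp: xe Np_def Q_def)
  have N: "(0, b, c - y) \<in> Np" using x unfolding xe by (rule Np_minus_diag)
  have xs: "x = (y, 0, y) + (0, b, c - y)" by (simp add: xe)
  show "x \<in> {(y, 0, y) | y. y \<in> supported_on (Id_on (- supp \<Gamma>2))} +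
      {(0, b1, b2) | b1 b2. (0, b1, b2) \<in> Np}"
    unfolding xs using y N by (intro set_plus_intro) blast+
qed

lemma alg_M_eq: "alg_M \<Gamma>2 = M"
  by (simp add: alg_M_def alg_d2_eq)

end

theorem theorem2:
  fixes \<Gamma>1 \<Gamma>2 :: "('n::{finite,linorder} \<times> 'n) set"
    and \<tau> :: "'n \<times> 'n \<Rightarrow> 'n \<times> 'n"
    and \<tau>h :: "'n cmat \<Rightarrow> 'n cmat"
  assumes "BD_triple \<Gamma>1 \<Gamma>2 \<tau>"
    and "assoc_extension \<Gamma>1 \<Gamma>2 \<tau> \<tau>h"
    and "no_stable_points \<Gamma>1 \<tau>h"
  shows "associative_triple mat3_vs.scale mult3 (alg_M \<Gamma>2) form_M
    (alg_D \<Gamma>1 \<Gamma>2 \<tau>h + alg_Nplus \<Gamma>1 \<Gamma>2 \<tau>h) (alg_D \<Gamma>1 \<Gamma>2 \<tau>h + alg_Nminus)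
    alg_Nminus (alg_D \<Gamma>1 \<Gamma>2 \<tau>h) (alg_Nplus \<Gamma>1 \<Gamma>2 \<tau>h)"
proof -
  interpret extended_BD_triple \<Gamma>1 \<Gamma>2 \<tau> \<tau>h
    using assms by (rule extended_BD_triple.intro)
  show ?thesis
    unfolding alg_M_eq alg_D_eq alg_Nplus_eq by (rule coordinate_triple)
qed

end
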